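(* Let $p,q\in\mathbb{N}$ (positive integers), $p-1<\alpha<p$, and consider the fully discrete scheme $$D_{\Delta t}^\alpha u_{i,j}-D_{\Delta x}^{(q)}\widetilde K(u_{i,j})=0$$ for the PDE $D_t^\alpha u-D_x^qK([u]_x)=0$, on a uniform spatial grid $x_i$ and time nodes $t_j$. For all $\rho(t_j)$ and $\bar G=\bar G(x_i,t_j,u_{i,j})$ such that $$\rho(t_j)\,D_{\Delta t}^\alpha u_{i,j}=D_{\Delta t}\big(\bar G(x_i,t_j,u_{i,j})\big),$$ the quantities $$x_i^k\rho(t_j)\big(D_{\Delta t}^\alpha u_{i,j}-D_{\Delta x}^{(q)}\widetilde K(u_{i,j})\big),\qquad k=0,\ldots,q-1,$$ are (discrete) conservation laws of the scheme at the point $(x_i,t_j)$, and they approximate their continuous counterparts $$x^k\rho(t)\big(D_t^\alpha u-D_x^qK([u]_x)\big),\qquad k=0,\ldots,q-1,$$ with the same accuracy as the method.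
   Context: PDE: $u=u(x,t)$, $(x,t)\in(a,b)\times(t_0,T)$; $[u]_x$ denotes $u$ and its integer-order space derivatives; $D_t^\alpha$ is the Riemann-Liouville derivative $D_t^p(I_t^{p-\alpha}u)$ or the Caputo derivative $I_t^{p-\alpha}(D_t^pu)$, with $I_t^{p-\alpha}f=\frac1{\Gamma(p-\alpha)}\int_{t_0}^t\frac{f(x,\tau)}{(t-\tau)^{1-p+\alpha}}d\tau$. Grid: $x_i=a+i\Delta x$, $i=0,\ldots,M+1$, $\Delta x=(b-a)/(M+1)$; $t_0<t_1<\dots<t_N=T$, $t_{j+1}=t_j+\Delta t_j$ (not necessarily uniform; the subscript of $\Delta t_j$ is omitted in operators). $u_{i,j}$ denotes the approximation of $u(x_i,t_j)$ and $D_{\Delta t}^\alpha u_{i,j}$ the approximation of $D_t^\alpha u(x_i,t_j)$ produced by the chosen time integrator; $\widetilde K\approx K$ is an arbitrary discretization of $K$. Operators: $D_{\Delta x}f_{i,j}=(f_{i+1,j}-f_{i,j})/\Delta x$ and $D_{\Delta t}f_{i,j}=(f_{i,j+1}-f_{i,j})/\Delta t_j$ are forward differences; $D^{(q)}_{\Delta x}$ is the second-order centred difference operator for the $q$-th derivative: $D^{(1)}_{\Delta x}f_{i,j}=(f_{i+1,j}-f_{i-1,j})/(2\Delta x)$, $D^{(2)}_{\Delta x}f_{i,j}=(f_{i+1,j}-2f_{i,j}+f_{i-1,j})/\Delta x^2$, $D^{(2\lambda)}_{\Delta x}=(D^{(2)}_{\Delta x})^\lambda$, $D^{(2\lambda+1)}_{\Delta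 x}=(D^{(2)}_{\Delta x})^\lambda D^{(1)}_{\Delta x}$. All identities are understood at grid points where the stencils are defined. A discrete conservation law of the scheme is an expression that can be written as $$D_{\Delta x}\widetilde F(x_i,t_j,u_{i,j})+D_{\Delta t}\widetilde G(x_i,t_j,u_{i,j})$$ and that vanishes on solutions of the scheme, where $\widetilde F,\widetilde G$ are discretizations of the flux and density of a continuous conservation law (a total divergence $D_xF+D_tG$ vanishing on solutions of the PDE). Functions written as $g(x_i,t_j,u_{i,j})$ are allowed to depend on the values of the discrete function $u$ at other grid points as well. "Same accuracy as the method" means: if, for smooth $u$ sampled on the grid, $D_{\Delta t}^\alpha u_{i,j}-D_{\Delta x}^{(q)}\widetilde K(u_{i,j})$ approximates $D_t^\alpha u-D_x^qK([u]_x)$ at $(x_i,t_j)$ with an error of a certain order, then the discrete quantity with factor $x_i^k\rho(t_j)$ approximates the continuous quantity with factor $x^k\rho(t)$ at $(x_i,t_j)$ with an error of the same order. *)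

theory Defs
  imports "HOL-Analysis.Analysis"
begin

text \<open>Functions of space and time are curried, \<open>u x t\<close>.  A functional maps such a function \<open>u\<close>
  to another one; differential expressions, fluxes and densities are functionals.\<close>

type_synonym field2 = "real \<Rightarrow> real \<Rightarrow> real"
type_synonym functional = "field2 \<Rightarrow> field2"

definition frac_integral :: "real \<Rightarrow> nat \<Rightarrow> real \<Rightarrow> field2 \<Rightarrow> field2" where
  "frac_integral t0 p \<alpha> f x t =
     (1 / Gamma (real p - \<alpha>)) * integral {t0..t} (\<lambda>s. f x s / (t - s) powr (1 - real p + \<alpha>))"

definition rl_deriv :: "real \<Rightarrow> nat \<Rightarrow> real \<Rightarrow> functional" where
  "rl_deriv t0 p \<alpha> u x t = (deriv ^^ p) (\<lambda>s. frac_integral t0 p \<alpha> u x s) t"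

definition caputo_deriv :: "real \<Rightarrow> nat \<Rightarrow> real \<Rightarrow> functional" where
  "caputo_deriv t0 p \<alpha> u x t = frac_integral t0 p \<alpha> (\<lambda>y s. (deriv ^^ p) (\<lambda>r. u y r) s) x t"

definition dx_pow :: "nat \<Rightarrow> field2 \<Rightarrow> field2" where
  "dx_pow m f x t = (deriv ^^ m) (\<lambda>y. f y t) x"

text \<open>\<open>K([u]\<^sub>x)\<close> for a function \<open>\<kappa>\<close> of the list \<open>[u, D\<^sub>x u, \<dots>, D\<^sub>x\<^sup>d u]\<close>.\<close>

definition jet_functional :: "nat \<Rightarrow> (real list \<Rightarrow> real) \<Rightarrow> functional" where
  "jet_functional d \<kappa> u x t = \<kappa> (map (\<lambda>m. dx_pow m u x t) [0..<Suc d])"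

definition st_domain :: "real \<Rightarrow> real \<Rightarrow> real \<Rightarrow> real \<Rightarrow> (real \<times> real) set" where
  "st_domain a b t0 T = {a<..<b} \<times> {t0<..<T}"

text \<open>Infinitely differentiable on the closed rectangle (one-sided derivatives on its boundary);
  \<open>D m l\<close> is the mixed partial derivative of order \<open>m\<close> in space and \<open>l\<close> in time.\<close>

definition smooth_on_rect :: "real \<Rightarrow> real \<Rightarrow> real \<Rightarrow> real \<Rightarrow> field2 \<Rightarrow> bool" where
  "smooth_on_rect a b t0 T u \<longleftrightarrow>
     (\<exists>D :: nat \<Rightarrow> nat \<Rightarrow> field2.
        (\<forall>x\<in>{a..b}. \<forall>t\<in>{t0..T}. D 0 0 x t = u x t) \<and>
        (\<forall>m l. continuous_on ({a..b} \<times> {t0..T}) (\<lambda>(x, t). D m l x t)) \<and>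
        (\<forall>m l. \<forall>x\<in>{a..b}. \<forall>t\<in>{t0..T}.
           ((\<lambda>y. D m l y t) has_real_derivative D (Suc m) l x t) (at x within {a..b}) \<and>
           ((\<lambda>s. D m l x s) has_real_derivative D m (Suc l) x t) (at t within {t0..T})))"

text \<open>The smooth functions on which the equation \<open>Dt u - D\<^sub>x\<^sup>q (K u) = 0\<close> makes classical sense.  For
  Riemann-Liouville and Caputo derivatives the second condition holds for all smooth \<open>u\<close>, and the
  last two do if \<open>K\<close> is a smooth function of the jet; they matter only when \<open>K\<close> has singularities.\<close>

definition admissible ::
  "real \<Rightarrow> real \<Rightarrow> real \<Rightarrow> real \<Rightarrow> functional \<Rightarrow> nat \<Rightarrow> functional \<Rightarrow> field2 \<Rightarrow> bool" where
  "admissible a b t0 T Dt q K u \<longleftrightarrow>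
     smooth_on_rect a b t0 T u \<and>
     continuous_on (st_domain a b t0 T) (\<lambda>(x, t). Dt u x t) \<and>
     (\<forall>m<q. \<forall>(x, t)\<in>st_domain a b t0 T. (\<lambda>y. dx_pow m (K u) y t) differentiable (at x)) \<and>
     (\<forall>m\<le>q. continuous_on (st_domain a b t0 T) (\<lambda>(x, t). dx_pow m (K u) x t))"

definition pde_residual :: "functional \<Rightarrow> nat \<Rightarrow> functional \<Rightarrow> functional" where
  "pde_residual Dt q K u x t = Dt u x t - dx_pow q (K u) x t"

text \<open>\<open>Q\<close> is a total divergence on the class \<open>A\<close> of functions, and vanishes on the solutions of \<open>R u = 0\<close>.\<close>

definition conservation_law ::
  "(field2 \<Rightarrow> bool) \<Rightarrow> (real \<times> real) set \<Rightarrow> functional \<Rightarrow> functional \<Rightarrow> functional \<Rightarrow> functional \<Rightarrow> bool" where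
  "conservation_law A \<Omega> R Q F G \<longleftrightarrow>
     (\<forall>u. A u \<longrightarrow> (\<forall>(x, t)\<in>\<Omega>.
        (\<lambda>y. F u y t) differentiable (at x) \<and> (\<lambda>s. G u x s) differentiable (at t) \<and>
        Q u x t = deriv (\<lambda>y. F u y t) x + deriv (\<lambda>s. G u x s) t)) \<and>
     (\<forall>u. A u \<and> (\<forall>(x, t)\<in>\<Omega>. R u x t = 0) \<longrightarrow> (\<forall>(x, t)\<in>\<Omega>. Q u x t = 0))"

record grid =
  left_end :: real
  right_end :: real
  n_space :: nat
  n_time :: nat
  time_node :: "nat \<Rightarrow> real"

definition dx :: "grid \<Rightarrow> real" where
  "dx g = (right_end g - left_end g) / (real (n_space g) + 1)"

definition space_node :: "grid \<Rightarrow> int \<Rightarrow> real" where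
  "space_node g i = left_end g + of_int i * dx g"

definition dt :: "grid \<Rightarrow> nat \<Rightarrow> real" where
  "dt g j = time_node g (Suc j) - time_node g j"

definition grid_on :: "real \<Rightarrow> real \<Rightarrow> real \<Rightarrow> real \<Rightarrow> grid \<Rightarrow> bool" where
  "grid_on a b t0 T g \<longleftrightarrow>
     left_end g = a \<and> right_end g = b \<and> 0 < n_time g \<and>
     time_node g 0 = t0 \<and> time_node g (n_time g) = T \<and> (\<forall>j<n_time g. 0 < dt g j)"

text \<open>Orders of accuracy refer to a sequence of grids whose steps in space and time tend to zero.\<close>

definition grid_family :: "real \<Rightarrow> real \<Rightarrow> real \<Rightarrow> real \<Rightarrow> (nat \<Rightarrow> grid) \<Rightarrow> bool" where
  "grid_family a b t0 T g \<longleftrightarrow>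
     (\<forall>n. grid_on a b t0 T (g n)) \<and>
     (\<lambda>n. dx (g n)) \<longlonglongrightarrow> 0 \<and>
     (\<lambda>n. Max (dt (g n) ` {..<n_time (g n)})) \<longlonglongrightarrow> 0"

definition grid_points :: "grid \<Rightarrow> (int \<times> nat) set" where
  "grid_points g = {0..int (n_space g) + 1} \<times> {..n_time g}"

text \<open>The grid points at distance at least \<open>r\<close> cells from the spatial boundary, \<open>s\<^sub>0\<close> levels from the
  initial time and \<open>s\<^sub>1\<close> levels from the final time: there the stencils of a scheme are defined.\<close>

definition stencil_points :: "nat \<Rightarrow> nat \<Rightarrow> nat \<Rightarrow> grid \<Rightarrow> (int \<times> nat) set" where
  "stencil_points r s0 s1 g =
     {(i, j). int r \<le> i \<and> i \<le> int (n_space g) + 1 - int r \<and> s0 \<le> j \<and> j + s1 \<le> n_time g}"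

definition node :: "grid \<Rightarrow> int \<times> nat \<Rightarrow> real \<times> real" where
  "node g = (\<lambda>(i, j). (space_node g i, time_node g j))"

text \<open>Grid functions are total for convenience; only the values at the grid points have a meaning.\<close>

type_synonym grid_fun = "int \<Rightarrow> nat \<Rightarrow> real"

text \<open>A discrete expression \<open>g(x\<^sub>i, t\<^sub>j, u\<^sub>i\<^sub>,\<^sub>j)\<close>, which may involve all values of \<open>u\<close> and
  depends on the grid: \<open>\<Phi> n u i j\<close> is its value at the point \<open>(i, j)\<close> of the \<open>n\<close>-th grid.\<close>

type_synonym discrete_functional = "nat \<Rightarrow> grid_fun \<Rightarrow> grid_fun"

definition fwd_x :: "grid \<Rightarrow> grid_fun \<Rightarrow> grid_fun" where
  "fwd_x g f i j = (f (i + 1) j - f i j) / dx g"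

definition fwd_t :: "grid \<Rightarrow> grid_fun \<Rightarrow> grid_fun" where
  "fwd_t g f i j = (f i (Suc j) - f i j) / dt g j"

definition centred1 :: "grid \<Rightarrow> grid_fun \<Rightarrow> grid_fun" where
  "centred1 g f i j = (f (i + 1) j - f (i - 1) j) / (2 * dx g)"

definition centred2 :: "grid \<Rightarrow> grid_fun \<Rightarrow> grid_fun" where
  "centred2 g f i j = (f (i + 1) j - 2 * f i j + f (i - 1) j) / (dx g)\<^sup>2"

definition centred :: "grid \<Rightarrow> nat \<Rightarrow> grid_fun \<Rightarrow> grid_fun" where
  "centred g q f = (if even q then (centred2 g ^^ (q div 2)) f
                    else (centred2 g ^^ (q div 2)) (centred1 g f))"

definition sample :: "grid \<Rightarrow> field2 \<Rightarrow> grid_fun" where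
  "sample g u i j = u (space_node g i) (time_node g j)"

definition sampling_error ::
  "(nat \<Rightarrow> grid) \<Rightarrow> discrete_functional \<Rightarrow> functional \<Rightarrow> field2 \<Rightarrow> nat \<Rightarrow> int \<Rightarrow> nat \<Rightarrow> real" where
  "sampling_error g \<Phi>h \<Phi> u n i j =
     \<bar>\<Phi>h n (sample (g n) u) i j - \<Phi> u (space_node (g n) i) (time_node (g n) j)\<bar>"

text \<open>Convergence is locally uniform in the open domain \<open>\<Omega>\<close>, so nothing is required where stencils
  cross the boundary or where a Riemann-Liouville derivative is singular at the initial time.\<close>

definition discretizes ::
  "(field2 \<Rightarrow> bool) \<Rightarrow> (real \<times> real) set \<Rightarrow> (nat \<Rightarrow> grid) \<Rightarrow> discrete_functional \<Rightarrow> functional \<Rightarrow> bool" where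
  "discretizes A \<Omega> g \<Phi>h \<Phi> \<longleftrightarrow>
     (\<forall>u C. A u \<and> compact C \<and> C \<subseteq> \<Omega> \<longrightarrow>
        (\<forall>\<epsilon>>0. \<forall>\<^sub>F n in sequentially. \<forall>(i, j)\<in>grid_points (g n).
           node (g n) (i, j) \<in> C \<longrightarrow> sampling_error g \<Phi>h \<Phi> u n i j < \<epsilon>))"

text \<open>The error at the nodes lying in \<open>P\<close> is \<open>O(e)\<close>, where \<open>e n\<close> is an arbitrary function of the
  grid, for example a sum of powers of the steps.  For a singleton \<open>P\<close> this is the order at a point.\<close>

definition accurate_to_order ::
  "(nat \<Rightarrow> grid) \<Rightarrow> (nat \<Rightarrow> (int \<times> nat) set) \<Rightarrow> (real \<times> real) set \<Rightarrow> (nat \<Rightarrow> real) \<Rightarrow>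
     discrete_functional \<Rightarrow> functional \<Rightarrow> field2 \<Rightarrow> bool" where
  "accurate_to_order g pts P e \<Phi>h \<Phi> u \<longleftrightarrow>
     (\<exists>c. \<forall>\<^sub>F n in sequentially. \<forall>(i, j)\<in>pts n.
        node (g n) (i, j) \<in> P \<longrightarrow> sampling_error g \<Phi>h \<Phi> u n i j \<le> c * e n)"

definition scheme_residual ::
  "(nat \<Rightarrow> grid) \<Rightarrow> discrete_functional \<Rightarrow> nat \<Rightarrow> discrete_functional \<Rightarrow> discrete_functional" where
  "scheme_residual g Dh q Kh n u i j = Dh n u i j - centred (g n) q (Kh n u) i j"

text \<open>\<open>Qh\<close> is a discrete conservation law, with flux \<open>Fh\<close> and density \<open>Gh\<close>, of the scheme \<open>Rh = 0\<close>
  imposed at the points \<open>pts\<close>; its continuous counterpart is the conservation law \<open>Q\<close> of \<open>R = 0\<close>.\<close>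

definition discrete_conservation_law ::
  "(field2 \<Rightarrow> bool) \<Rightarrow> (real \<times> real) set \<Rightarrow> (nat \<Rightarrow> grid) \<Rightarrow> (nat \<Rightarrow> (int \<times> nat) set) \<Rightarrow>
     discrete_functional \<Rightarrow> functional \<Rightarrow> discrete_functional \<Rightarrow> functional \<Rightarrow>
     discrete_functional \<Rightarrow> discrete_functional \<Rightarrow> bool" where
  "discrete_conservation_law A \<Omega> g pts Rh R Qh Q Fh Gh \<longleftrightarrow>
     (\<forall>n u. \<forall>(i, j)\<in>pts n. Qh n u i j = fwd_x (g n) (Fh n u) i j + fwd_t (g n) (Gh n u) i j) \<and>
     (\<forall>n u. (\<forall>(i, j)\<in>pts n. Rh n u i j = 0) \<longrightarrow> (\<forall>(i, j)\<in>pts n. Qh n u i j = 0)) \<and>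
     (\<exists>F G. conservation_law A \<Omega> R Q F G \<and> discretizes A \<Omega> g Fh F \<and> discretizes A \<Omega> g Gh G)"

text \<open>\<open>Fh\<close> at \<open>(i, j)\<close> is a function of the values of \<open>Kh\<close> at no more than \<open>w\<close> cells from \<open>i\<close> and at the
  same time level.  For a flux this excludes summing the conserved quantity over the whole grid.\<close>

definition local_in ::
  "nat \<Rightarrow> discrete_functional \<Rightarrow> discrete_functional \<Rightarrow> bool" where
  "local_in w Kh Fh \<longleftrightarrow>
     (\<forall>n u v i j. (\<forall>l. \<bar>l - i\<bar> \<le> int w \<longrightarrow> Kh n u l j = Kh n v l j) \<longrightarrow> Fh n u i j = Fh n v i j)"

end

theory Submission
  imports Defs
begin

text \<open>Up to shifts and, for odd \<open>q\<close>, an average, \<open>D\<^sup>(\<^sup>q\<^sup>)\<close> is the \<open>q\<close>-th power of the forward difference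
  \<open>D\<close>.  Since \<open>D\<close> to the power \<open>k + 1\<close> annihilates \<open>x\<^sup>k\<close>, summation by parts writes \<open>x\<^sup>k D\<^sup>(\<^sup>q\<^sup>) K\<close> as
  \<open>D\<close> of a local flux if \<open>k < q\<close>.  This flux contains differences of \<open>K\<close> of orders below \<open>q\<close>, of which
  consistency of the scheme says nothing directly: they converge because those of orders \<open>0\<close> and \<open>q\<close>
  do, by a discrete Landau--Kolmogorov inequality.  The density is normalised by subtracting its
  value at a node next to a fixed time; it is then a Riemann sum that converges to an
  antiderivative of \<open>\<rho>\<close> times the fractional derivative.\<close>

text \<open>The inequality is applied to the error between the discretized \<open>K\<close> and the
  samples of its limit. Its order \<open>q\<close> is known to vanish because the spatial term is
  the difference of two consistent quantities, the time part and the full residual. Lower orders are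
  reached downwards from \<open>q\<close>. The obstacle is that smallness of the error comes without
  a rate, so dividing it by powers of one cell width proves nothing; differences over many cells,
  spanning a fixed physical length, are divided by powers of that length instead. Each use loses a
  strip at the right end of a rectangle, which is harmless because convergence is only claimed
  locally uniformly in an open domain. The density has to be normalised because its defining
  identity leaves open a term independent of time, which may vary arbitrarily with the grid. The
  reference time is interior because the fractional derivative may be singular at \<open>t0\<close>.
  Accuracy needs no analysis: the multiplier is evaluated exactly at the nodes.\<close>

section \<open>Forward differences, summation by parts and the centred operators\<close>

lemma fwd_x_shift: "fwd_x h (\<lambda>i j. f (i + c) j) = (\<lambda>i j. fwd_x h f (i + c) j)"
  by (simp add: fwd_x_def fun_eq_iff algebra_simps)

lemma fwd_x_funpow_shift:
  "(fwd_x h ^^ m) (\<lambda>i j. f (i + c) j) = (\<lambda>i j. (fwd_x h ^^ m) f (i + c) j)"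
  by (induction m) (simp_all add: fwd_x_shift)

lemma fwd_x_funpow_diff:
  "(fwd_x h ^^ m) (\<lambda>i j. f i j - f' i j) = (\<lambda>i j. (fwd_x h ^^ m) f i j - (fwd_x h ^^ m) f' i j)"
  by (induction m) (auto simp: fwd_x_def fun_eq_iff diff_divide_distrib)

lemma fwd_x_funpow_local:
  assumes "\<And>l. i \<le> l \<Longrightarrow> l \<le> i + int m \<Longrightarrow> f l j = f' l j"
  shows "(fwd_x h ^^ m) f i j = (fwd_x h ^^ m) f' i j"
  using assms
proof (induction m arbitrary: i)
  case (Suc m)
  have "(fwd_x h ^^ m) f i j = (fwd_x h ^^ m) f' i j"
    "(fwd_x h ^^ m) f (i + 1) j = (fwd_x h ^^ m) f' (i + 1) j"
    by (rule Suc.IH; use Suc.prems in force)+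
  then show ?case by (simp add: fwd_x_def [of h "(fwd_x h ^^ m) f" for f])
qed simp

text \<open>The factor left unshifted is the one that will carry the monomial. The shift falls on
  the other factor, which is the origin of the arguments \<open>i + int m\<close> in the flux. For
  \<open>dx h = 0\<close> all quotients are 0 by convention.\<close>

lemma fwd_x_mult:
  "fwd_x h (\<lambda>i j. f i j * f' i j) i j = f i j * fwd_x h f' i j + fwd_x h f i j * f' (i + 1) j"
  by (cases "dx h = 0") (simp_all add: fwd_x_def field_simps)

text \<open>The product rule splits each summand into two terms, and consecutive summands cancel one
  of them. Stopping at \<open>k\<close> leaves a remainder containing the difference of order
  \<open>k + 1\<close> of \<open>\<phi>\<close>, which vanishes when \<open>\<phi>\<close> is the
  monomial of degree \<open>k\<close>.\<close>

lemma summation_by_parts: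
  assumes "k < q"
  shows "fwd_x h (\<lambda>i j. \<Sum>m\<le>k. (-1) ^ m * ((fwd_x h ^^ m) \<phi> i j * (fwd_x h ^^ (q - 1 - m)) w (i + int m) j)) i j
    = \<phi> i j * (fwd_x h ^^ q) w i j
      + (-1) ^ k * ((fwd_x h ^^ Suc k) \<phi> i j * (fwd_x h ^^ (q - 1 - k)) w (i + 1 + int k) j)"
  using assms
proof (induction k)
  case 0
  then obtain q' where "q = Suc q'" by (cases q) auto
  then show ?case by (simp add: fwd_x_mult)
next
  case (Suc k)
  have add: "fwd_x h (\<lambda>i j. f i j + c * f' i j) i j = fwd_x h f i j + c * fwd_x h f' i j" for f f' c
    by (cases "dx h = 0") (simp_all add: fwd_x_def field_simps)
  have "q - 1 - k = Suc (q - 1 - Suc k)" using Suc.prems by simp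
  \<comment> \<open>This is the factor already present in the remainder of the induction hypothesis:
    order and shift agree, and the alternating sign makes the two terms cancel.\<close>
  then have step: "fwd_x h (\<lambda>i j. (fwd_x h ^^ (q - 1 - Suc k)) w (i + int (Suc k)) j) i j
      = (fwd_x h ^^ (q - 1 - k)) w (i + 1 + int k) j"
    by (simp only: fwd_x_shift funpow.simps comp_def) (simp add: algebra_simps)
  have IH: "fwd_x h (\<lambda>i j. \<Sum>m\<le>k. (-1) ^ m * ((fwd_x h ^^ m) \<phi> i j * (fwd_x h ^^ (q - 1 - m)) w (i + int m) j)) i j
    = \<phi> i j * (fwd_x h ^^ q) w i j
      + (-1) ^ k * ((fwd_x h ^^ Suc k) \<phi> i j * (fwd_x h ^^ (q - 1 - k)) w (i + 1 + int k) j)"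
    by (rule Suc.IH) (use Suc.prems in simp)
  have "fwd_x h (\<lambda>i j. \<Sum>m\<le>Suc k. (-1) ^ m * ((fwd_x h ^^ m) \<phi> i j * (fwd_x h ^^ (q - 1 - m)) w (i + int m) j)) i j
     = fwd_x h (\<lambda>i j. \<Sum>m\<le>k. (-1) ^ m * ((fwd_x h ^^ m) \<phi> i j * (fwd_x h ^^ (q - 1 - m)) w (i + int m) j)) i j
       + (-1) ^ Suc k * fwd_x h (\<lambda>i j. (fwd_x h ^^ Suc k) \<phi> i j * (fwd_x h ^^ (q - 1 - Suc k)) w (i + int (Suc k)) j) i j"
    by (simp only: sum.atMost_Suc add)
  also have "\<dots> = \<phi> i j * (fwd_x h ^^ q) w i j
      + (-1) ^ Suc k * ((fwd_x h ^^ Suc (Suc k)) \<phi> i j * (fwd_x h ^^ (q - 1 - Suc k)) w (i + 1 + int (Suc k)) j)"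
    by (simp only: IH fwd_x_mult step) (simp add: algebra_simps)
  finally show ?case .
qed

text \<open>Since \<open>D\<^sup>(\<^sup>1\<^sup>)\<close> annihilates checkerboard grid functions, the average is needed for odd \<open>q\<close>:
  differences of the grid function itself need not converge.\<close>

definition centring :: "nat \<Rightarrow> grid_fun \<Rightarrow> grid_fun" where
  "centring q f i j = (if even q then f (i + (- int (q div 2))) j
     else (f (i + (- int (q div 2))) j + f (i + (- int (q div 2) - 1)) j) / 2)"

text \<open>One \<open>centred2\<close> is two forward differences moved back by one cell, so each
  power adds two to the order and one cell to the shift.\<close>

lemma centred2_funpow:
  "(centred2 h ^^ l) f = (fwd_x h ^^ (2 * l)) (\<lambda>i j. f (i + (- int l)) j)"
proof (induction l)
  case (Suc l)
  have c2: "centred2 h f i j = fwd_x h (fwd_x h f) (i + (- 1)) j" for f i j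
    by (cases "dx h = 0") (simp_all add: centred2_def fwd_x_def field_simps power2_eq_square)
  have "(centred2 h ^^ Suc l) f = (\<lambda>i j. (fwd_x h ^^ (2 * Suc l)) (\<lambda>i j. f (i + (- int l)) j) (i + (- 1)) j)"
    by (intro ext) (simp add: Suc.IH c2)
  also have "\<dots> = (fwd_x h ^^ (2 * Suc l)) (\<lambda>i j. f (i + (- 1) + (- int l)) j)"
    by (rule fwd_x_funpow_shift [symmetric])
  finally show ?case by (simp add: algebra_simps del: mult_Suc_right)
qed simp

lemma centred_eq_fwd_x: "centred h q f = (fwd_x h ^^ q) (centring q f)"
proof (cases "even q")
  case True
  then have "2 * (q div 2) = q" by simp
  moreover have "(\<lambda>i j. f (i + (- int (q div 2))) j) = centring q f"
    using True by (simp add: centring_def fun_eq_iff)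
  ultimately show ?thesis
    using True by (simp only: centred_def centred2_funpow if_True)
next
  case False
  then have q: "q = Suc (2 * (q div 2))" by presburger
  \<comment> \<open>The wide central difference is the forward difference of a two-cell mean, which
    supplies the one missing order when \<open>q\<close> is odd.\<close>
  have "centred1 h f i j = fwd_x h (\<lambda>i j. (f i j + f (i - 1) j) / 2) i j" for i j
    by (cases "dx h = 0") (simp_all add: centred1_def fwd_x_def field_simps)
  then have c1: "centred1 h f = fwd_x h (\<lambda>i j. (f i j + f (i - 1) j) / 2)"
    by (simp add: fun_eq_iff)
  have "(\<lambda>i j. centred1 h f (i + (- int (q div 2))) j) = fwd_x h (centring q f)"
    unfolding c1 fwd_x_shift [symmetric]
    using False by (intro arg_cong [where f = "fwd_x h"] ext) (simp add: centring_def algebra_simps)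
  then have "centred h q f = (fwd_x h ^^ (2 * (q div 2))) (fwd_x h (centring q f))"
    using False by (simp only: centred_def centred2_funpow if_False)
  also have "\<dots> = (fwd_x h ^^ Suc (2 * (q div 2))) (centring q f)"
    by (simp only: funpow_Suc_right comp_def)
  finally show ?thesis using q by simp
qed

section \<open>Mean value theorem for divided differences\<close>

text \<open>The difference quotients of a chain of successive derivatives form such a chain again,
  so induction applies to them; one ordinary mean value step then resolves the last quotient and
  extends the interval by one cell. Besides convergence of sampled differences, this yields that
  differences of order \<open>k + 1\<close> annihilate the monomial of degree
  \<open>k\<close>.\<close>

lemma fwd_x_mean_value:
  assumes "0 < dx h" "\<And>i. f i j = F 0 (space_node h i)"
    and "\<And>l x. l < m \<Longrightarrow> space_node h i \<le> x \<Longrightarrow> x \<le> space_node h i + real m * dx h \<Longrightarrow>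
      (F l has_real_derivative F (Suc l) x) (at x)"
  shows "\<exists>\<xi>. space_node h i \<le> \<xi> \<and> \<xi> \<le> space_node h i + real m * dx h \<and> (fwd_x h ^^ m) f i j = F m \<xi>"
  using assms(2-)
proof (induction m arbitrary: F f)
  case 0
  then show ?case by auto
next
  case (Suc m)
  define F' where "F' l x = (F l (x + dx h) - F l x) / dx h" for l x
  have "fwd_x h f i j = F' 0 (space_node h i)" for i
    by (simp add: fwd_x_def F'_def Suc.prems(1) space_node_def algebra_simps)
  moreover have "(F' l has_real_derivative F' (Suc l) x) (at x)"
    if "l < m" "space_node h i \<le> x" "x \<le> space_node h i + real m * dx h" for l x
  proof -
    have "(F l has_real_derivative F (Suc l) (x + dx h)) (at (x + dx h))"
      "(F l has_real_derivative F (Suc l) x) (at x)"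
      using that assms(1) by (auto intro!: Suc.prems(2) simp: algebra_simps)
    then have "((\<lambda>x. F l (x + dx h) - F l x) has_real_derivative F (Suc l) (x + dx h) - F (Suc l) x) (at x)"
      by (intro DERIV_diff) (simp_all add: DERIV_shift)
    then show ?thesis
      unfolding F'_def by (rule DERIV_cdivide)
  qed
  ultimately obtain \<xi> where \<xi>: "space_node h i \<le> \<xi>" "\<xi> \<le> space_node h i + real m * dx h"
    "(fwd_x h ^^ m) (fwd_x h f) i j = F' m \<xi>"
    using Suc.IH [of "fwd_x h f" F'] by blast
  have "\<exists>z. \<xi> < z \<and> z < \<xi> + dx h \<and> F m (\<xi> + dx h) - F m \<xi> = (\<xi> + dx h - \<xi>) * F (Suc m) z"
    by (rule MVT2) (use \<xi> assms(1) in \<open>auto intro!: Suc.prems(2) simp: algebra_simps\<close>)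
  then obtain z where "\<xi> < z" "z < \<xi> + dx h" "F' m \<xi> = F (Suc m) z"
    using assms(1) by (auto simp: F'_def)
  with \<xi> show ?case
    by (intro exI [of _ z]) (simp add: funpow_Suc_right algebra_simps del: funpow.simps)
qed

section \<open>A discrete Landau-Kolmogorov inequality\<close>

text \<open>Undivided, so that differences over one cell and over \<open>N\<close> cells can be
  compared without reference to a cell width.\<close>

definition step_diff :: "nat \<Rightarrow> (int \<Rightarrow> real) \<Rightarrow> int \<Rightarrow> real" where
  "step_diff N f i = f (i + int N) - f i"

lemma step_diff_funpow_abs_le:
  assumes "\<And>l. i \<le> l \<Longrightarrow> l \<le> i + int (m * N) \<Longrightarrow> \<bar>f l\<bar> \<le> B"
  shows "\<bar>(step_diff N ^^ m) f i\<bar> \<le> 2 ^ m * B"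
  using assms
proof (induction m arbitrary: i)
  case (Suc m)
  have "\<bar>(step_diff N ^^ m) f i\<bar> \<le> 2 ^ m * B"
    "\<bar>(step_diff N ^^ m) f (i + int N)\<bar> \<le> 2 ^ m * B"
    by (rule Suc.IH; use Suc.prems in \<open>force simp: algebra_simps\<close>)+
  then show ?case by (simp add: step_diff_def [of N "(step_diff N ^^ m) f"])
qed auto

lemma step_diff_funpow_sum:
  "(step_diff N ^^ m) (\<lambda>i. \<Sum>l\<in>I. f (i + l)) i = (\<Sum>l\<in>I. (step_diff N ^^ m) f (i + l))"
  by (induction m arbitrary: i) (simp_all add: step_diff_def sum_subtractf algebra_simps)

lemma step_diff_eq_sum: "step_diff N f = (\<lambda>i. \<Sum>l\<in>{0..<int N}. step_diff 1 f (i + l))"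
proof -
  have "step_diff N f i = (\<Sum>l<N. step_diff 1 f (i + int l))" for i
    by (induction N) (simp_all add: step_diff_def algebra_simps)
  moreover have "(\<Sum>l\<in>{0..<int N}. step_diff 1 f (i + l)) = (\<Sum>l<N. step_diff 1 f (i + int l))" for i
    by (rule sum.reindex_bij_witness [of _ int nat]) auto
  ultimately show ?thesis by auto
qed

lemma step_diff_variation:
  assumes "\<And>l. i \<le> l \<Longrightarrow> l < i + int n \<Longrightarrow> \<bar>step_diff 1 f l\<bar> \<le> B"
  shows "\<bar>f (i + int n) - f i\<bar> \<le> real n * B"
  using assms
proof (induction n)
  case (Suc n)
  have "\<bar>f (i + int n) - f i\<bar> \<le> real n * B" by (rule Suc.IH) (use Suc.prems in auto)
  moreover have "\<bar>step_diff 1 f (i + int n)\<bar> \<le> B" by (rule Suc.prems) auto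
  ultimately show ?case by (simp add: step_diff_def algebra_simps)
qed simp

text \<open>An \<open>N\<close>-step difference is a sum of \<open>N\<close> one-step differences, which are nearly equal
  if the difference of next order is small.\<close>

lemma step_diff_funpow_approx:
  assumes "\<And>l. i \<le> l \<Longrightarrow> l \<le> i + int (m * N) \<Longrightarrow> \<bar>(step_diff 1 ^^ Suc m) f l\<bar> \<le> B"
  shows "\<bar>(step_diff N ^^ m) f i - real N ^ m * (step_diff 1 ^^ m) f i\<bar> \<le> real m * real N ^ Suc m * B"
  using assms
proof (induction m arbitrary: f i)
  case 0
  then show ?case by simp
next
  case (Suc m)
  let ?e = "step_diff 1"
  have B: "0 \<le> B" using Suc.prems [of i] by auto
  \<comment> \<open>Two errors add up. The induction hypothesis for the one-step difference of
    \<open>f\<close>, based at \<open>i + l\<close>, costs \<open>m * N ^ (m + 1) * B\<close>.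
    Moving the base point back to \<open>i\<close> crosses at most \<open>N\<close> cells, at a cost
    of at most \<open>B\<close> each, and this is multiplied by \<open>N ^ m\<close>.\<close>
  have est: "\<bar>(step_diff N ^^ m) (?e f) (i + l) - real N ^ m * (?e ^^ Suc m) f i\<bar>
      \<le> real (Suc m) * real N ^ Suc m * B" if l: "l \<in> {0..<int N}" for l
  proof -
    have "\<bar>(step_diff N ^^ m) (?e f) (i + l) - real N ^ m * (?e ^^ m) (?e f) (i + l)\<bar>
        \<le> real m * real N ^ Suc m * B"
    proof (rule Suc.IH)
      fix l' assume "i + l \<le> l'" "l' \<le> i + l + int (m * N)"
      then have "\<bar>(?e ^^ Suc (Suc m)) f l'\<bar> \<le> B"
        using l by (intro Suc.prems) (auto simp: algebra_simps)
      then show "\<bar>(?e ^^ Suc m) (?e f) l'\<bar> \<le> B"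
        by (simp only: funpow_Suc_right [of "Suc m"] comp_def)
    qed
    moreover have "\<bar>(?e ^^ Suc m) f (i + int (nat l)) - (?e ^^ Suc m) f i\<bar> \<le> real (nat l) * B"
    proof (rule step_diff_variation)
      fix l' assume "i \<le> l'" and "l' < i + int (nat l)"
      then have "l' \<le> i + int N" using l by simp
      also have "\<dots> \<le> i + int (Suc m * N)" by simp
      finally have "\<bar>(?e ^^ Suc (Suc m)) f l'\<bar> \<le> B"
        by (rule Suc.prems [OF \<open>i \<le> l'\<close>])
      then show "\<bar>?e ((?e ^^ Suc m) f) l'\<bar> \<le> B" by (simp only: funpow.simps comp_def)
    qed
    then have "\<bar>(?e ^^ Suc m) f (i + l) - (?e ^^ Suc m) f i\<bar> \<le> real N * B"
      using l B by (auto elim!: order_trans intro!: mult_right_mono)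
    then have "real N ^ m * \<bar>(?e ^^ Suc m) f (i + l) - (?e ^^ Suc m) f i\<bar> \<le> real N ^ m * (real N * B)"
      by (intro mult_left_mono) auto
    then have "\<bar>real N ^ m * (?e ^^ Suc m) f (i + l) - real N ^ m * (?e ^^ Suc m) f i\<bar> \<le> real N ^ Suc m * B"
      by (simp only: right_diff_distrib [symmetric] abs_mult) (simp add: mult_ac)
    moreover have "(?e ^^ m) (?e f) = (?e ^^ Suc m) f"
      by (simp only: funpow_Suc_right comp_def)
    ultimately show ?thesis by (simp add: algebra_simps)
  qed
  have "(step_diff N ^^ Suc m) f i = (step_diff N ^^ m) (\<lambda>i. \<Sum>l\<in>{0..<int N}. ?e f (i + l)) i"
    by (simp only: funpow_Suc_right comp_def step_diff_eq_sum [of N f])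
  also have "\<dots> = (\<Sum>l\<in>{0..<int N}. (step_diff N ^^ m) (?e f) (i + l))"
    by (rule step_diff_funpow_sum)
  finally have "(step_diff N ^^ Suc m) f i - real N ^ Suc m * (?e ^^ Suc m) f i
      = (\<Sum>l\<in>{0..<int N}. (step_diff N ^^ m) (?e f) (i + l) - real N ^ m * (?e ^^ Suc m) f i)"
    by (simp add: sum_subtractf)
  also have "\<bar>\<dots>\<bar> \<le> (\<Sum>l\<in>{0..<int N}. real (Suc m) * real N ^ Suc m * B)"
    by (intro sum_abs [THEN order_trans] sum_mono est)
  also have "\<dots> = real (Suc m) * real N ^ Suc (Suc m) * B" by simp
  finally show ?case .
qed

lemma step_diff_funpow_fwd_x:
  assumes "dx h \<noteq> 0"
  shows "(step_diff 1 ^^ m) (\<lambda>i. f i j) i = dx h ^ m * (fwd_x h ^^ m) f i j"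
  using assms by (induction m arbitrary: i) (simp_all add: step_diff_def fwd_x_def field_simps)

text \<open>Let \<open>H = N * dx h\<close>. The difference of order \<open>m\<close> with span
  \<open>N\<close> is at most \<open>2 ^ m * B0\<close>, and it differs from \<open>H ^ m\<close>
  times the divided difference by at most \<open>m * H ^ (m + 1) * B1\<close>; dividing by
  \<open>H ^ m\<close> gives the claim. The span \<open>H\<close> remains at the user's
  disposal.\<close>

lemma fwd_x_interpolation:
  assumes h: "0 < dx h" and N: "0 < N"
    and "\<And>l. i \<le> l \<Longrightarrow> l \<le> i + int (m * N) \<Longrightarrow> \<bar>f l j\<bar> \<le> B0"
    and "\<And>l. i \<le> l \<Longrightarrow> l \<le> i + int (m * N) \<Longrightarrow> \<bar>(fwd_x h ^^ Suc m) f l j\<bar> \<le> B1"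
  shows "\<bar>(fwd_x h ^^ m) f i j\<bar> \<le> 2 ^ m * B0 / (real N * dx h) ^ m + real m * (real N * dx h) * B1"
proof -
  let ?H = "real N * dx h"
  have "\<bar>(step_diff 1 ^^ Suc m) (\<lambda>i. f i j) l\<bar> \<le> dx h ^ Suc m * B1"
    if "i \<le> l" "l \<le> i + int (m * N)" for l
  proof -
    have "(step_diff 1 ^^ Suc m) (\<lambda>i. f i j) l = dx h ^ Suc m * (fwd_x h ^^ Suc m) f l j"
      by (rule step_diff_funpow_fwd_x) (use h in simp)
    then show ?thesis
      using assms(4) [OF that] h by (simp only: abs_mult) (simp add: mult_left_mono)
  qed
  then have "\<bar>(step_diff N ^^ m) (\<lambda>i. f i j) i - real N ^ m * (step_diff 1 ^^ m) (\<lambda>i. f i j) i\<bar>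
      \<le> real m * real N ^ Suc m * (dx h ^ Suc m * B1)"
    by (rule step_diff_funpow_approx)
  moreover have "(step_diff 1 ^^ m) (\<lambda>i. f i j) i = dx h ^ m * (fwd_x h ^^ m) f i j"
    by (rule step_diff_funpow_fwd_x) (use h in simp)
  moreover have "\<bar>(step_diff N ^^ m) (\<lambda>i. f i j) i\<bar> \<le> 2 ^ m * B0"
    by (rule step_diff_funpow_abs_le) (use assms(3) in auto)
  ultimately have "\<bar>?H ^ m * (fwd_x h ^^ m) f i j\<bar> \<le> 2 ^ m * B0 + real m * ?H ^ Suc m * B1"
    by (simp add: power_mult_distrib algebra_simps)
  moreover have H: "0 < ?H ^ m" using h N by simp
  ultimately have "\<bar>(fwd_x h ^^ m) f i j\<bar> \<le> (2 ^ m * B0 + real m * ?H ^ Suc m * B1) / ?H ^ m"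
    by (simp add: abs_mult pos_le_divide_eq mult.commute del: power_mult_distrib)
  also have "\<dots> = 2 ^ m * B0 / ?H ^ m + real m * ?H * B1"
    using H by (simp add: add_divide_distrib del: power_mult_distrib)
  finally show ?thesis .
qed

section \<open>The fluxes and their divergence identities\<close>

text \<open>The derivative of order \<open>m\<close> of the monomial of degree \<open>k\<close>. For
  \<open>m > k\<close> the product contains the factor with \<open>i = k\<close>, so the value is 0
  although the exponent \<open>k - m\<close> is truncated.\<close>

definition monomial_deriv :: "nat \<Rightarrow> nat \<Rightarrow> real \<Rightarrow> real" where
  "monomial_deriv k m x = (\<Prod>i<m. real k - real i) * x ^ (k - m)"

lemma monomial_deriv_0: "monomial_deriv k 0 x = x ^ k"
  by (simp add: monomial_deriv_def)

lemma monomial_deriv_Suc_self: "monomial_deriv k (Suc k) x = 0"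
  by (simp add: monomial_deriv_def)

lemma monomial_deriv_has_derivative:
  "(monomial_deriv k m has_real_derivative monomial_deriv k (Suc m) x) (at x)"
proof -
  have "(monomial_deriv k m has_real_derivative
      (\<Prod>i<m. real k - real i) * (real (k - m) * x ^ (k - m - Suc 0))) (at x)"
    unfolding monomial_deriv_def [abs_def] by (auto intro!: derivative_eq_intros)
  moreover have "(\<Prod>i<m. real k - real i) = 0" if "k < m"
    using that by auto
  then have "(\<Prod>i<m. real k - real i) * (real (k - m) * x ^ (k - m - Suc 0)) = monomial_deriv k (Suc m) x"
    by (cases "k < m") (auto simp: monomial_deriv_def of_nat_diff)
  ultimately show ?thesis by simp
qed

lemma continuous_on_monomial_deriv: "continuous_on S (\<lambda>z. monomial_deriv k m (fst z))"
  unfolding monomial_deriv_def by (intro continuous_intros)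

text \<open>The result of integrating \<open>x ^ k * dx_pow q \<phi>\<close> by parts until the
  monomial is exhausted. The leading minus is the sign of the spatial term in the residual.\<close>

definition flux :: "(real \<Rightarrow> real) \<Rightarrow> nat \<Rightarrow> nat \<Rightarrow> field2 \<Rightarrow> field2" where
  "flux \<rho> k q \<phi> x t =
     - (\<rho> t * (\<Sum>m\<le>k. (-1) ^ m * (monomial_deriv k m x * dx_pow (q - 1 - m) \<phi> x t)))"

text \<open>The monomial enters through its differences rather than its derivatives, so that the
  divergence identity is exact on every grid and not only in the limit.\<close>

definition discrete_flux :: "grid \<Rightarrow> (real \<Rightarrow> real) \<Rightarrow> nat \<Rightarrow> nat \<Rightarrow> grid_fun \<Rightarrow> grid_fun" where
  "discrete_flux h \<rho> k q f i j =
     - (\<rho> (time_node h j) * (\<Sum>m\<le>k. (-1) ^ m *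
          ((fwd_x h ^^ m) (sample h (\<lambda>x t. x ^ k)) i j * (fwd_x h ^^ (q - 1 - m)) (centring q f) (i + int m) j)))"

text \<open>The cancellation of \<open>summation_by_parts\<close> with derivatives in place of
  differences, and hence without shifts. \<open>P\<close> and \<open>D\<close> stand for the
  successive derivatives of the two factors at the point \<open>x\<close>.\<close>

lemma leibniz_telescope:
  fixes P D :: "nat \<Rightarrow> real \<Rightarrow> real"
  assumes "\<And>m. (P m has_real_derivative P (Suc m) x) (at x)"
    and "\<And>m. m < q \<Longrightarrow> (D m has_real_derivative D (Suc m) x) (at x)" and "k < q"
  shows "((\<lambda>y. \<Sum>m\<le>k. (-1) ^ m * (P m y * D (q - 1 - m) y)) has_real_derivative
      P 0 x * D q x + (-1) ^ k * (P (Suc k) x * D (q - 1 - k) x)) (at x)"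
  using assms(3)
proof (induction k)
  case 0
  then have "((\<lambda>y. P 0 y * D (q - 1) y) has_real_derivative
      P (Suc 0) x * D (q - 1) x + D (Suc (q - 1)) x * P 0 x) (at x)"
    by (intro DERIV_mult assms) auto
  then show ?case using 0 by (simp add: algebra_simps)
next
  case (Suc k)
  have "((\<lambda>y. (-1) ^ Suc k * (P (Suc k) y * D (q - 1 - Suc k) y)) has_real_derivative
      (-1) ^ Suc k * (P (Suc (Suc k)) x * D (q - 1 - Suc k) x + D (Suc (q - 1 - Suc k)) x * P (Suc k) x)) (at x)"
    using Suc.prems by (intro DERIV_cmult DERIV_mult assms) auto
  moreover have "Suc (q - 1 - Suc k) = q - 1 - k" using Suc.prems by simp
  moreover have "((\<lambda>y. \<Sum>m\<le>k. (-1) ^ m * (P m y * D (q - 1 - m) y)) has_real_derivative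
      P 0 x * D q x + (-1) ^ k * (P (Suc k) x * D (q - 1 - k) x)) (at x)"
    using Suc by simp
  ultimately have "((\<lambda>y. (\<Sum>m\<le>k. (-1) ^ m * (P m y * D (q - 1 - m) y)) + (-1) ^ Suc k * (P (Suc k) y * D (q - 1 - Suc k) y))
      has_real_derivative (P 0 x * D q x + (-1) ^ k * (P (Suc k) x * D (q - 1 - k) x))
        + (-1) ^ Suc k * (P (Suc (Suc k)) x * D (q - 1 - Suc k) x + D (q - 1 - k) x * P (Suc k) x)) (at x)"
    by (intro DERIV_add) simp_all
  moreover have "(P 0 x * D q x + (-1) ^ k * (P (Suc k) x * D (q - 1 - k) x))
        + (-1) ^ Suc k * (P (Suc (Suc k)) x * D (q - 1 - Suc k) x + D (q - 1 - k) x * P (Suc k) x)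
      = P 0 x * D q x + (-1) ^ Suc k * (P (Suc (Suc k)) x * D (q - 1 - Suc k) x)"
    by (simp add: algebra_simps)
  ultimately show ?case by (simp only: sum.atMost_Suc)
qed

lemma dx_pow_has_derivative:
  assumes "(\<lambda>y. dx_pow m \<phi> y t) differentiable (at x)"
  shows "((\<lambda>y. dx_pow m \<phi> y t) has_real_derivative dx_pow (Suc m) \<phi> x t) (at x)"
  using assms by (simp add: dx_pow_def DERIV_deriv_iff_real_differentiable [symmetric])

lemma flux_has_derivative:
  assumes "\<And>m. m < q \<Longrightarrow> (\<lambda>y. dx_pow m \<phi> y t) differentiable (at x)" "k < q"
  shows "((\<lambda>y. flux \<rho> k q \<phi> y t) has_real_derivative - (x ^ k * \<rho> t * dx_pow q \<phi> x t)) (at x)"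
proof -
  have "((\<lambda>y. \<Sum>m\<le>k. (-1) ^ m * (monomial_deriv k m y * dx_pow (q - 1 - m) \<phi> y t)) has_real_derivative
      monomial_deriv k 0 x * dx_pow q \<phi> x t
      + (-1) ^ k * (monomial_deriv k (Suc k) x * dx_pow (q - 1 - k) \<phi> x t)) (at x)"
    by (rule leibniz_telescope [where D = "\<lambda>m y. dx_pow m \<phi> y t"])
      (simp_all add: assms monomial_deriv_has_derivative dx_pow_has_derivative)
  then have "((\<lambda>y. flux \<rho> k q \<phi> y t) has_real_derivative - (\<rho> t * (x ^ k * dx_pow q \<phi> x t))) (at x)"
    unfolding flux_def
    by (intro DERIV_minus DERIV_cmult) (simp add: monomial_deriv_0 monomial_deriv_Suc_self)
  then show ?thesis by (simp add: mult_ac)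
qed

lemma fwd_x_discrete_flux:
  assumes "0 < dx h" "k < q"
  shows "fwd_x h (discrete_flux h \<rho> k q f) i j
    = - (space_node h i ^ k * \<rho> (time_node h j) * centred h q f i j)"
proof -
  let ?S = "\<lambda>i j. \<Sum>m\<le>k. (-1) ^ m *
    ((fwd_x h ^^ m) (sample h (\<lambda>x t. x ^ k)) i j * (fwd_x h ^^ (q - 1 - m)) (centring q f) (i + int m) j)"
  \<comment> \<open>The mean value theorem gives exact vanishing here, since the derivative of order
    \<open>k + 1\<close> is 0 at whatever intermediate point it selects; no binomial identity is
    involved.\<close>
  have "\<exists>\<xi>. space_node h i \<le> \<xi> \<and> \<xi> \<le> space_node h i + real (Suc k) * dx h \<and>
      (fwd_x h ^^ Suc k) (sample h (\<lambda>x t. x ^ k)) i j = monomial_deriv k (Suc k) \<xi>"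
    by (rule fwd_x_mean_value [OF assms(1)])
      (simp_all add: sample_def monomial_deriv_0 monomial_deriv_has_derivative)
  then have "(fwd_x h ^^ Suc k) (sample h (\<lambda>x t. x ^ k)) i j = 0"
    by (auto simp: monomial_deriv_Suc_self simp del: funpow.simps)
  then have "fwd_x h ?S i j = space_node h i ^ k * centred h q f i j"
    unfolding summation_by_parts [OF assms(2)] centred_eq_fwd_x by (simp add: sample_def del: funpow.simps)
  moreover have "fwd_x h (discrete_flux h \<rho> k q f) i j = - (\<rho> (time_node h j) * fwd_x h ?S i j)"
  proof -
    have "fwd_x h (\<lambda>i j. - (\<rho> (time_node h j) * S i j)) i j = - (\<rho> (time_node h j) * fwd_x h S i j)" for S
      by (simp add: fwd_x_def right_diff_distrib diff_divide_distrib)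
    then show ?thesis by (simp only: discrete_flux_def [abs_def])
  qed
  ultimately show ?thesis by (simp add: mult_ac)
qed

text \<open>The \<open>m\<close>-th term starts at \<open>i + m\<close> and looks
  \<open>q - 1 - m\<close> cells ahead, so it ends at \<open>i + q - 1\<close> for every
  \<open>m\<close>. Centring reaches back by \<open>q div 2\<close> cells, and by one more if
  \<open>q\<close> is odd.\<close>

lemma discrete_flux_local:
  assumes eq: "\<And>l. \<bar>l - i\<bar> \<le> int q \<Longrightarrow> f l j = f' l j" and "k < q"
  shows "discrete_flux h \<rho> k q f i j = discrete_flux h \<rho> k q f' i j"
proof -
  have "(fwd_x h ^^ (q - 1 - m)) (centring q f) (i + int m) j
      = (fwd_x h ^^ (q - 1 - m)) (centring q f') (i + int m) j" if "m \<le> k" for m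
  proof (rule fwd_x_funpow_local)
    fix l assume l: "i + int m \<le> l" "l \<le> i + int m + int (q - 1 - m)"
    then have l': "i \<le> l" "l \<le> i + int q - 1" using that \<open>k < q\<close> by auto
    show "centring q f l j = centring q f' l j"
    proof (cases "even q")
      case True
      then show ?thesis unfolding centring_def using l' by (simp, intro eq) linarith
    next
      case False
      \<comment> \<open>Equality holds for \<open>q = 1\<close>, where the mean uses the cell to the
        left of \<open>i\<close>.\<close>
      then have "int (q div 2) + 1 \<le> int q" by presburger
      then have "f (l + (- int (q div 2))) j = f' (l + (- int (q div 2))) j"
        "f (l + (- int (q div 2) - 1)) j = f' (l + (- int (q div 2) - 1)) j"
        using l' by (intro eq; linarith)+
      then show ?thesis unfolding centring_def by simp
    qed
  qed
  then show ?thesis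
    unfolding discrete_flux_def by (intro arg_cong [where f = uminus] arg_cong2 [where f = "(*)"] sum.cong) auto
qed

section \<open>Convergence of grid functions on interior rectangles\<close>

locale grid_refinement =
  fixes a b t0 T :: real and g :: "nat \<Rightarrow> grid"
  assumes ab: "a < b" and tT: "t0 < T" and family: "grid_family a b t0 T g"
begin

text \<open>The time index is bounded explicitly because nothing is known of
  \<open>time_node\<close> past the final time. Space nodes are given by a formula for all integers,
  so the interior ones are grid points automatically.\<close>

definition window :: "nat \<Rightarrow> real \<Rightarrow> real \<Rightarrow> real \<Rightarrow> real \<Rightarrow> (int \<times> nat) set" where
  "window n x1 x2 \<tau>1 \<tau>2 =
     {(i, j). j \<le> n_time (g n) \<and> node (g n) (i, j) \<in> {x1..x2} \<times> {\<tau>1..\<tau>2}}"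

text \<open>The content of \<open>discretizes\<close> for a single function, with rectangles in
  place of compact sets: rectangles can be enlarged slightly inside the open domain, which shifts
  and differences require.\<close>

definition converges :: "(nat \<Rightarrow> grid_fun) \<Rightarrow> field2 \<Rightarrow> bool" where
  "converges f \<phi> \<longleftrightarrow> (\<forall>x1 x2 \<tau>1 \<tau>2. a < x1 \<and> x2 < b \<and> t0 < \<tau>1 \<and> \<tau>2 < T \<longrightarrow>
     (\<forall>\<epsilon>>0. \<forall>\<^sub>F n in sequentially. \<forall>(i, j)\<in>window n x1 x2 \<tau>1 \<tau>2.
        \<bar>f n i j - \<phi> (space_node (g n) i) (time_node (g n) j)\<bar> < \<epsilon>))"

definition max_dt :: "nat \<Rightarrow> real" where
  "max_dt n = Max (dt (g n) ` {..<n_time (g n)})"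

lemma convergesI:
  assumes "\<And>x1 x2 \<tau>1 \<tau>2 \<epsilon>. a < x1 \<Longrightarrow> x2 < b \<Longrightarrow> t0 < \<tau>1 \<Longrightarrow> \<tau>2 < T \<Longrightarrow> 0 < \<epsilon> \<Longrightarrow>
    \<forall>\<^sub>F n in sequentially. \<forall>(i, j)\<in>window n x1 x2 \<tau>1 \<tau>2.
      \<bar>f n i j - \<phi> (space_node (g n) i) (time_node (g n) j)\<bar> < \<epsilon>"
  shows "converges f \<phi>"
  using assms by (auto simp: converges_def)

lemma convergesD:
  assumes "converges f \<phi>" "a < x1" "x2 < b" "t0 < \<tau>1" "\<tau>2 < T" "0 < \<epsilon>"
  shows "\<forall>\<^sub>F n in sequentially. \<forall>(i, j)\<in>window n x1 x2 \<tau>1 \<tau>2.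
      \<bar>f n i j - \<phi> (space_node (g n) i) (time_node (g n) j)\<bar> < \<epsilon>"
  using assms by (auto simp: converges_def)

lemma mem_window:
  "(i, j) \<in> window n x1 x2 \<tau>1 \<tau>2 \<longleftrightarrow> j \<le> n_time (g n) \<and>
     x1 \<le> space_node (g n) i \<and> space_node (g n) i \<le> x2 \<and>
     \<tau>1 \<le> time_node (g n) j \<and> time_node (g n) j \<le> \<tau>2"
  by (auto simp: window_def node_def)

lemma dx_pos: "0 < dx (g n)"
  using ab family by (simp add: grid_family_def grid_on_def dx_def)

lemma dx_lim: "(\<lambda>n. dx (g n)) \<longlonglongrightarrow> 0"
  using family by (simp add: grid_family_def)

lemma max_dt_lim: "max_dt \<longlonglongrightarrow> 0"
  using family by (simp add: grid_family_def max_dt_def [abs_def])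

lemma space_node_add: "space_node (g n) (i + c) = space_node (g n) i + of_int c * dx (g n)"
  by (simp add: space_node_def algebra_simps)

lemma space_node_interior:
  assumes "a < space_node (g n) i" "space_node (g n) i < b"
  shows "0 < i \<and> i < int (n_space (g n)) + 1"
proof -
  have "space_node (g n) 0 = a" "space_node (g n) (int (n_space (g n)) + 1) = b"
    using family by (simp_all add: grid_family_def grid_on_def dx_def space_node_def)
  moreover have less: "i < i'" if "space_node (g n) i < space_node (g n) i'" for i i'
    using that dx_pos [of n] by (simp add: space_node_def)
  ultimately show ?thesis
    using assms less [of 0 i] less [of i "int (n_space (g n)) + 1"] by simp
qed

lemma time_node_0: "time_node (g n) 0 = t0"
  and time_node_last: "time_node (g n) (n_time (g n)) = T"
  and dt_pos: "j < n_time (g n) \<Longrightarrow> 0 < dt (g n) j"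
  using family by (simp_all add: grid_family_def grid_on_def)

lemma time_node_Suc: "time_node (g n) (Suc j) = time_node (g n) j + dt (g n) j"
  by (simp add: dt_def)

lemma dt_le_max_dt: "j < n_time (g n) \<Longrightarrow> dt (g n) j \<le> max_dt n"
  unfolding max_dt_def by (intro Max_ge) auto

lemma time_node_mono:
  assumes "j \<le> j'" "j' \<le> n_time (g n)"
  shows "time_node (g n) j \<le> time_node (g n) j'"
  using assms
proof (induction j' rule: dec_induct)
  case (step j')
  then show ?case using dt_pos [of j' n] by (simp add: time_node_Suc)
qed simp

lemma time_node_le:
  assumes "j \<le> j'" "j' \<le> n_time (g n)"
  shows "time_node (g n) j' \<le> time_node (g n) j + real (j' - j) * max_dt n"
  using assms
proof (induction j' rule: dec_induct)
  case (step j')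
  then show ?case
    using dt_le_max_dt [of j' n] by (simp add: time_node_Suc Suc_diff_le algebra_simps)
qed simp

lemma eventually_le_of_null:
  assumes "h \<longlonglongrightarrow> (0::real)" "0 < \<delta>"
  shows "\<forall>\<^sub>F n in sequentially. c * h n < \<delta>"
proof -
  have "(\<lambda>n. c * h n) \<longlonglongrightarrow> c * 0" by (intro tendsto_intros assms)
  then show ?thesis using assms(2) by (auto dest: order_tendstoD(2))
qed

lemma compact_in_window:
  assumes "compact C" "C \<subseteq> st_domain a b t0 T"
  obtains x1 x2 \<tau>1 \<tau>2 where "a < x1" "x2 < b" "t0 < \<tau>1" "\<tau>2 < T" "C \<subseteq> {x1..x2} \<times> {\<tau>1..\<tau>2}"
proof -
  have interval: "\<exists>y z. c < y \<and> z < d \<and> S \<subseteq> {y..z}"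
    if S: "compact S" "S \<subseteq> {c<..<d}" "c < d" for S :: "real set" and c d
  proof (cases "S = {}")
    case True
    \<comment> \<open>The midpoint is a default value: an empty set lies in every interval.\<close>
    then show ?thesis using S(3) by (auto intro!: exI [of _ "(c + d) / 2"])
  next
    case False
    obtain y where y: "y \<in> S" "\<forall>t\<in>S. y \<le> t" using compact_attains_inf [OF S(1) False] by blast
    obtain z where z: "z \<in> S" "\<forall>t\<in>S. t \<le> z" using compact_attains_sup [OF S(1) False] by blast
    show ?thesis using y z S(2) by (intro exI [of _ y] exI [of _ z]) auto
  qed
  have "compact (fst ` C)" "compact (snd ` C)"
    using assms(1) by (auto intro!: compact_continuous_image continuous_intros)
  moreover have "fst ` C \<subseteq> {a<..<b}" "snd ` C \<subseteq> {t0<..<T}"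
    using assms(2) by (auto simp: st_domain_def)
  ultimately obtain x1 x2 \<tau>1 \<tau>2 where w: "a < x1" "x2 < b" "t0 < \<tau>1" "\<tau>2 < T"
    "fst ` C \<subseteq> {x1..x2}" "snd ` C \<subseteq> {\<tau>1..\<tau>2}"
    using interval [of "fst ` C" a b] interval [of "snd ` C" t0 T] ab tT by blast
  have "C \<subseteq> fst ` C \<times> snd ` C" by (rule subset_fst_snd)
  also have "\<dots> \<subseteq> {x1..x2} \<times> {\<tau>1..\<tau>2}" by (intro Sigma_mono w)
  finally show ?thesis by (rule that [OF w(1-4)])
qed

text \<open>Rectangles are compact, and conversely every compact subset of the open domain lies in a
  rectangle that stays away from the boundary. Nodes in such a rectangle belong to the grid.\<close>

lemma discretizes_iff:
  "discretizes A (st_domain a b t0 T) g \<Phi>h \<Phi> \<longleftrightarrow> (\<forall>u. A u \<longrightarrow> converges (\<lambda>n. \<Phi>h n (sample (g n) u)) (\<Phi> u))"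
  (is "?L \<longleftrightarrow> ?R")
proof
  assume L: ?L
  show ?R
  proof (intro allI impI convergesI)
    fix u x1 x2 \<tau>1 \<tau>2 and \<epsilon> :: real
    assume "A u" and w: "a < x1" "x2 < b" "t0 < \<tau>1" "\<tau>2 < T" and "0 < \<epsilon>"
    have sub: "{x1..x2} \<times> {\<tau>1..\<tau>2} \<subseteq> st_domain a b t0 T"
      using w by (auto simp: st_domain_def)
    moreover have "compact ({x1..x2} \<times> {\<tau>1..\<tau>2})" by (intro compact_Times) auto
    ultimately have "\<forall>\<^sub>F n in sequentially. \<forall>(i, j)\<in>grid_points (g n).
        node (g n) (i, j) \<in> {x1..x2} \<times> {\<tau>1..\<tau>2} \<longrightarrow> sampling_error g \<Phi>h \<Phi> u n i j < \<epsilon>"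
      using L \<open>A u\<close> \<open>0 < \<epsilon>\<close> unfolding discretizes_def by blast
    then show "\<forall>\<^sub>F n in sequentially. \<forall>(i, j)\<in>window n x1 x2 \<tau>1 \<tau>2.
        \<bar>\<Phi>h n (sample (g n) u) i j - \<Phi> u (space_node (g n) i) (time_node (g n) j)\<bar> < \<epsilon>"
    proof eventually_elim
      case (elim n)
      show ?case
      proof (intro ballI, clarify)
        fix i j assume ij: "(i, j) \<in> window n x1 x2 \<tau>1 \<tau>2"
        have gp: "(i, j) \<in> grid_points (g n)"
          using ij w space_node_interior [of n i] by (auto simp: mem_window grid_points_def)
        have "node (g n) (i, j) \<in> {x1..x2} \<times> {\<tau>1..\<tau>2}"
          using ij by (simp add: window_def)
        then have "sampling_error g \<Phi>h \<Phi> u n i j < \<epsilon>" using bspec [OF elim gp] by simp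
        then show "\<bar>\<Phi>h n (sample (g n) u) i j - \<Phi> u (space_node (g n) i) (time_node (g n) j)\<bar> < \<epsilon>"
          by (simp add: sampling_error_def)
      qed
    qed
  qed
next
  assume R: ?R
  show ?L unfolding discretizes_def
  proof (intro allI impI, elim conjE)
    fix u C and \<epsilon> :: real
    assume "A u" and C: "compact C" "C \<subseteq> st_domain a b t0 T" and "0 < \<epsilon>"
    obtain x1 x2 \<tau>1 \<tau>2 where w: "a < x1" "x2 < b" "t0 < \<tau>1" "\<tau>2 < T" "C \<subseteq> {x1..x2} \<times> {\<tau>1..\<tau>2}"
      by (rule compact_in_window [OF C])
    have "\<forall>\<^sub>F n in sequentially. \<forall>(i, j)\<in>window n x1 x2 \<tau>1 \<tau>2.
        \<bar>\<Phi>h n (sample (g n) u) i j - \<Phi> u (space_node (g n) i) (time_node (g n) j)\<bar> < \<epsilon>"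
      by (rule convergesD) (use R \<open>A u\<close> \<open>0 < \<epsilon>\<close> w in auto)
    then show "\<forall>\<^sub>F n in sequentially. \<forall>(i, j)\<in>grid_points (g n).
        node (g n) (i, j) \<in> C \<longrightarrow> sampling_error g \<Phi>h \<Phi> u n i j < \<epsilon>"
    proof eventually_elim
      case (elim n)
      show ?case
      proof (intro ballI, clarify)
        fix i j assume "(i, j) \<in> grid_points (g n)" "node (g n) (i, j) \<in> C"
        then have "(i, j) \<in> window n x1 x2 \<tau>1 \<tau>2"
          using w(5) by (auto simp: window_def grid_points_def)
        from bspec [OF elim this] show "sampling_error g \<Phi>h \<Phi> u n i j < \<epsilon>"
          by (simp add: sampling_error_def)
      qed
    qed
  qed
qed

abbreviation continuous_field :: "field2 \<Rightarrow> bool" where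
  "continuous_field \<phi> \<equiv> continuous_on (st_domain a b t0 T) (\<lambda>(x, t). \<phi> x t)"

lemma continuous_field_uniform:
  assumes "continuous_field \<phi>" "a < x1" "x2 < b" "t0 < \<tau>1" "\<tau>2 < T" "0 < \<epsilon>"
  obtains \<delta> where "0 < \<delta>"
    "\<forall>x\<in>{x1..x2}. \<forall>x'\<in>{x1..x2}. \<forall>t\<in>{\<tau>1..\<tau>2}. \<forall>t'\<in>{\<tau>1..\<tau>2}.
       \<bar>x - x'\<bar> + \<bar>t - t'\<bar> < \<delta> \<longrightarrow> \<bar>\<phi> x t - \<phi> x' t'\<bar> < \<epsilon>"
proof -
  let ?W = "{x1..x2} \<times> {\<tau>1..\<tau>2}"
  have "continuous_on ?W (\<lambda>(x, t). \<phi> x t)"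
    by (rule continuous_on_subset [OF assms(1)]) (use assms in \<open>auto simp: st_domain_def\<close>)
  then have "uniformly_continuous_on ?W (\<lambda>(x, t). \<phi> x t)"
    by (intro compact_uniformly_continuous compact_Times compact_Icc)
  then obtain \<delta> where \<delta>: "0 < \<delta>"
    "\<And>z z'. z \<in> ?W \<Longrightarrow> z' \<in> ?W \<Longrightarrow> dist z' z < \<delta> \<Longrightarrow> dist (case_prod \<phi> z') (case_prod \<phi> z) < \<epsilon>"
    using assms(6) unfolding uniformly_continuous_on_def by metis
  show ?thesis
  proof (rule that [OF \<delta>(1)], intro ballI impI)
    fix x x' t t'
    assume *: "x \<in> {x1..x2}" "x' \<in> {x1..x2}" "t \<in> {\<tau>1..\<tau>2}" "t' \<in> {\<tau>1..\<tau>2}" "\<bar>x - x'\<bar> + \<bar>t - t'\<bar> < \<delta>"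
    have "dist (x, t) (x', t') \<le> \<bar>x - x'\<bar> + \<bar>t - t'\<bar>"
      using sqrt_sum_squares_le_sum_abs [of "x - x'" "t - t'"] by (simp add: dist_Pair_Pair dist_real_def)
    then show "\<bar>\<phi> x t - \<phi> x' t'\<bar> < \<epsilon>"
      using \<delta>(2) [of "(x', t')" "(x, t)"] * by (auto simp: dist_real_def)
  qed
qed

lemma continuous_field_bounded:
  assumes "continuous_field \<phi>" "a < x1" "x2 < b" "t0 < \<tau>1" "\<tau>2 < T"
  obtains B where "0 < B" "\<forall>x\<in>{x1..x2}. \<forall>t\<in>{\<tau>1..\<tau>2}. \<bar>\<phi> x t\<bar> \<le> B"
proof -
  let ?W = "{x1..x2} \<times> {\<tau>1..\<tau>2}"
  have "continuous_on ?W (\<lambda>(x, t). \<phi> x t)"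
    by (rule continuous_on_subset [OF assms(1)]) (use assms in \<open>auto simp: st_domain_def\<close>)
  then have "bounded ((\<lambda>(x, t). \<phi> x t) ` ?W)"
    by (intro compact_imp_bounded compact_continuous_image compact_Times compact_Icc)
  then obtain B where B: "0 < B" "\<And>y. y \<in> (\<lambda>(x, t). \<phi> x t) ` ?W \<Longrightarrow> norm y \<le> B"
    unfolding bounded_pos by blast
  show ?thesis
  proof (rule that [OF B(1)], intro ballI)
    fix x t assume "x \<in> {x1..x2}" "t \<in> {\<tau>1..\<tau>2}"
    then have "(x, t) \<in> ?W" by simp
    then show "\<bar>\<phi> x t\<bar> \<le> B" using B(2) [of "\<phi> x t"] by force
  qed
qed

lemma converges_sample: "converges (\<lambda>n. sample (g n) \<phi>) \<phi>"
  by (rule convergesI) (simp add: sample_def)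

lemma converges_add:
  assumes "converges f \<phi>" "converges f' \<phi>'"
  shows "converges (\<lambda>n i j. f n i j + f' n i j) (\<lambda>x t. \<phi> x t + \<phi>' x t)"
proof (rule convergesI)
  fix x1 x2 \<tau>1 \<tau>2 \<epsilon> :: real
  assume w: "a < x1" "x2 < b" "t0 < \<tau>1" "\<tau>2 < T" and "0 < \<epsilon>"
  then have "0 < \<epsilon> / 2" by simp
  from convergesD [OF assms(1) w this] convergesD [OF assms(2) w this]
  show "\<forall>\<^sub>F n in sequentially. \<forall>(i, j)\<in>window n x1 x2 \<tau>1 \<tau>2.
      \<bar>f n i j + f' n i j - (\<phi> (space_node (g n) i) (time_node (g n) j) + \<phi>' (space_node (g n) i) (time_node (g n) j))\<bar> < \<epsilon>"
  proof eventually_elim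
    case (elim n)
    have add: "\<bar>y + y' - (z + z')\<bar> < \<epsilon>" if "\<bar>y - z\<bar> < \<epsilon> / 2" "\<bar>y' - z'\<bar> < \<epsilon> / 2" for y y' z z'
      using that by linarith
    show ?case
    proof (intro ballI, clarify)
      fix i j assume "(i, j) \<in> window n x1 x2 \<tau>1 \<tau>2"
      with elim show "\<bar>f n i j + f' n i j - (\<phi> (space_node (g n) i) (time_node (g n) j) + \<phi>' (space_node (g n) i) (time_node (g n) j))\<bar> < \<epsilon>"
        by (intro add) auto
    qed
  qed
qed

lemma converges_mult:
  assumes "converges f \<phi>" "converges f' \<phi>'" "continuous_field \<phi>" "continuous_field \<phi>'"
  shows "converges (\<lambda>n i j. f n i j * f' n i j) (\<lambda>x t. \<phi> x t * \<phi>' x t)"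
proof (rule convergesI)
  fix x1 x2 \<tau>1 \<tau>2 \<epsilon> :: real
  assume w: "a < x1" "x2 < b" "t0 < \<tau>1" "\<tau>2 < T" and "0 < \<epsilon>"
  obtain B where B: "0 < B" "\<forall>x\<in>{x1..x2}. \<forall>t\<in>{\<tau>1..\<tau>2}. \<bar>\<phi> x t\<bar> \<le> B"
    by (rule continuous_field_bounded [OF assms(3) w])
  obtain B' where B': "0 < B'" "\<forall>x\<in>{x1..x2}. \<forall>t\<in>{\<tau>1..\<tau>2}. \<bar>\<phi>' x t\<bar> \<le> B'"
    by (rule continuous_field_bounded [OF assms(4) w])
  \<comment> \<open>The cap 1 turns the product of the two errors into at most
    \<open>\<eta>\<close>; the mixed terms contribute \<open>B * \<eta>\<close> and
    \<open>\<eta> * B'\<close>, so the total stays below \<open>\<epsilon>\<close>.\<close>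
  define \<eta> where "\<eta> = min 1 (\<epsilon> / (1 + B + B'))"
  have pos: "0 < 1 + B + B'" using B(1) B'(1) by simp
  have "\<eta> \<le> \<epsilon> / (1 + B + B')" by (simp add: \<eta>_def)
  then have \<eta>: "\<eta> * (1 + B + B') \<le> \<epsilon>" "0 < \<eta>" "\<eta> \<le> 1"
    using \<open>0 < \<epsilon>\<close> pos by (simp add: pos_le_divide_eq, simp_all add: \<eta>_def)
  have est: "\<bar>y * y' - z * z'\<bar> < \<epsilon>"
    if "\<bar>y - z\<bar> < \<eta>" "\<bar>y' - z'\<bar> < \<eta>" "\<bar>z\<bar> \<le> B" "\<bar>z'\<bar> \<le> B'" for y y' z z'
  proof -
    have "y * y' - z * z' = (y - z) * (y' - z') + z * (y' - z') + (y - z) * z'"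
      by (simp add: algebra_simps)
    then have "\<bar>y * y' - z * z'\<bar> \<le> \<bar>y - z\<bar> * \<bar>y' - z'\<bar> + \<bar>z\<bar> * \<bar>y' - z'\<bar> + \<bar>y - z\<bar> * \<bar>z'\<bar>"
      by (simp only: abs_mult [symmetric])
    also have "\<bar>y - z\<bar> * \<bar>y' - z'\<bar> < \<eta> * 1"
      using that \<eta> by (intro mult_strict_mono) auto
    also have "\<bar>z\<bar> * \<bar>y' - z'\<bar> \<le> B * \<eta>"
      using that B(1) by (intro mult_mono) auto
    also have "\<bar>y - z\<bar> * \<bar>z'\<bar> \<le> \<eta> * B'"
      using that \<eta> by (intro mult_mono) auto
    finally show ?thesis using \<eta>(1) by (simp add: algebra_simps)
  qed
  from convergesD [OF assms(1) w \<eta>(2)] convergesD [OF assms(2) w \<eta>(2)]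
  show "\<forall>\<^sub>F n in sequentially. \<forall>(i, j)\<in>window n x1 x2 \<tau>1 \<tau>2.
      \<bar>f n i j * f' n i j - \<phi> (space_node (g n) i) (time_node (g n) j) * \<phi>' (space_node (g n) i) (time_node (g n) j)\<bar> < \<epsilon>"
  proof eventually_elim
    case (elim n)
    show ?case
    proof (intro ballI, clarify)
      fix i j assume ij: "(i, j) \<in> window n x1 x2 \<tau>1 \<tau>2"
      then show "\<bar>f n i j * f' n i j - \<phi> (space_node (g n) i) (time_node (g n) j) * \<phi>' (space_node (g n) i) (time_node (g n) j)\<bar> < \<epsilon>"
        using elim by (intro est B(2) [rule_format] B'(2) [rule_format]) (auto simp: mem_window)
    qed
  qed
qed

text \<open>The factor is sampled exactly, so a bound for it suffices. The limit of \<open>f\<close>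
  may thus be an antiderivative in time chosen separately for each \<open>x\<close>, whose joint
  continuity is not established.\<close>

lemma converges_mult_sample:
  assumes "converges f \<phi>" "continuous_field \<psi>"
  shows "converges (\<lambda>n i j. \<psi> (space_node (g n) i) (time_node (g n) j) * f n i j) (\<lambda>x t. \<psi> x t * \<phi> x t)"
proof (rule convergesI)
  fix x1 x2 \<tau>1 \<tau>2 \<epsilon> :: real
  assume w: "a < x1" "x2 < b" "t0 < \<tau>1" "\<tau>2 < T" and "0 < \<epsilon>"
  obtain B where B: "0 < B" "\<forall>x\<in>{x1..x2}. \<forall>t\<in>{\<tau>1..\<tau>2}. \<bar>\<psi> x t\<bar> \<le> B"
    by (rule continuous_field_bounded [OF assms(2) w])
  have "0 < \<epsilon> / B" using \<open>0 < \<epsilon>\<close> B(1) by simp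
  from convergesD [OF assms(1) w this]
  show "\<forall>\<^sub>F n in sequentially. \<forall>(i, j)\<in>window n x1 x2 \<tau>1 \<tau>2.
      \<bar>\<psi> (space_node (g n) i) (time_node (g n) j) * f n i j
        - \<psi> (space_node (g n) i) (time_node (g n) j) * \<phi> (space_node (g n) i) (time_node (g n) j)\<bar> < \<epsilon>"
  proof eventually_elim
    case (elim n)
    show ?case
    proof (intro ballI, clarify)
      fix i j assume ij: "(i, j) \<in> window n x1 x2 \<tau>1 \<tau>2"
      let ?x = "space_node (g n) i" and ?t = "time_node (g n) j"
      have "\<bar>\<psi> ?x ?t\<bar> \<le> B" using B(2) ij by (auto simp: mem_window)
      then have "\<bar>\<psi> ?x ?t\<bar> * \<bar>f n i j - \<phi> ?x ?t\<bar> \<le> B * \<bar>f n i j - \<phi> ?x ?t\<bar>"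
        by (rule mult_right_mono) simp
      also have "\<dots> < \<epsilon>"
        using bspec [OF elim ij] B(1) by (simp add: pos_less_divide_eq mult.commute)
      finally show "\<bar>\<psi> ?x ?t * f n i j - \<psi> ?x ?t * \<phi> ?x ?t\<bar> < \<epsilon>"
        by (simp add: right_diff_distrib [symmetric] abs_mult)
    qed
  qed
qed

lemma converges_cmult:
  assumes "converges f \<phi>"
  shows "converges (\<lambda>n i j. c * f n i j) (\<lambda>x t. c * \<phi> x t)"
  using converges_mult_sample [OF assms, of "\<lambda>x t. c"] by simp

lemma converges_diff:
  assumes "converges f \<phi>" "converges f' \<phi>'"
  shows "converges (\<lambda>n i j. f n i j - f' n i j) (\<lambda>x t. \<phi> x t - \<phi>' x t)"
proof -
  have "converges (\<lambda>n i j. - f' n i j) (\<lambda>x t. - \<phi>' x t)"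
    using assms(2) by (simp add: converges_def abs_minus_commute)
  from converges_add [OF assms(1) this] show ?thesis by simp
qed

lemma converges_sum:
  assumes "finite I" "\<And>m. m \<in> I \<Longrightarrow> converges (f m) (\<phi> m)"
  shows "converges (\<lambda>n i j. \<Sum>m\<in>I. f m n i j) (\<lambda>x t. \<Sum>m\<in>I. \<phi> m x t)"
  using assms
proof (induction I rule: finite_induct)
  case empty
  show ?case by (rule convergesI) simp
next
  case (insert m I)
  then show ?case by (simp add: converges_add)
qed

text \<open>A shift by a fixed number of cells moves the node by a distance tending to 0. The
  rectangle is widened on both sides to contain the shifted node, and uniform continuity compares
  the limit at the two nodes.\<close>

lemma converges_shift:
  assumes "converges f \<phi>" "continuous_field \<phi>"
  shows "converges (\<lambda>n i j. f n (i + c) j) \<phi>"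
proof (rule convergesI)
  fix x1 x2 \<tau>1 \<tau>2 \<epsilon> :: real
  assume w: "a < x1" "x2 < b" "t0 < \<tau>1" "\<tau>2 < T" and "0 < \<epsilon>"
  obtain y1 where "a < y1" "y1 < x1" using dense [OF w(1)] by blast
  moreover obtain y2 where "x2 < y2" "y2 < b" using dense [OF w(2)] by blast
  ultimately have y: "a < y1" "y1 < x1" "x2 < y2" "y2 < b" by auto
  obtain \<delta> where \<delta>: "0 < \<delta>"
    "\<forall>x\<in>{y1..y2}. \<forall>x'\<in>{y1..y2}. \<forall>t\<in>{\<tau>1..\<tau>2}. \<forall>t'\<in>{\<tau>1..\<tau>2}.
       \<bar>x - x'\<bar> + \<bar>t - t'\<bar> < \<delta> \<longrightarrow> \<bar>\<phi> x t - \<phi> x' t'\<bar> < \<epsilon> / 2"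
    by (rule continuous_field_uniform [OF assms(2) y(1,4) w(3,4), of "\<epsilon> / 2"]) (use \<open>0 < \<epsilon>\<close> in auto)
  have "\<forall>\<^sub>F n in sequentially. \<bar>of_int c\<bar> * dx (g n) < min \<delta> (min (x1 - y1) (y2 - x2))"
    using y \<delta> by (intro eventually_le_of_null dx_lim) auto
  moreover have "\<forall>\<^sub>F n in sequentially. \<forall>(i, j)\<in>window n y1 y2 \<tau>1 \<tau>2.
      \<bar>f n i j - \<phi> (space_node (g n) i) (time_node (g n) j)\<bar> < \<epsilon> / 2"
    using \<open>0 < \<epsilon>\<close> by (intro convergesD [OF assms(1)] y w) auto
  ultimately show "\<forall>\<^sub>F n in sequentially. \<forall>(i, j)\<in>window n x1 x2 \<tau>1 \<tau>2.
      \<bar>f n (i + c) j - \<phi> (space_node (g n) i) (time_node (g n) j)\<bar> < \<epsilon>"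
  proof eventually_elim
    case (elim n)
    show ?case
    proof (intro ballI, clarify)
      fix i j assume ij: "(i, j) \<in> window n x1 x2 \<tau>1 \<tau>2"
      let ?x = "space_node (g n) i" and ?y = "space_node (g n) (i + c)" and ?t = "time_node (g n) j"
      have "\<bar>?y - ?x\<bar> = \<bar>of_int c\<bar> * dx (g n)"
        using dx_pos [of n] by (simp add: space_node_add abs_mult)
      then have d: "\<bar>?y - ?x\<bar> < \<delta>" "\<bar>?y - ?x\<bar> < x1 - y1" "\<bar>?y - ?x\<bar> < y2 - x2"
        using elim(1) by auto
      then have "\<bar>\<phi> ?y ?t - \<phi> ?x ?t\<bar> < \<epsilon> / 2"
        using ij y d by (intro \<delta>(2) [rule_format]) (auto simp: mem_window)
      moreover have "(i + c, j) \<in> window n y1 y2 \<tau>1 \<tau>2"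
        using ij d by (auto simp: mem_window)
      then have "\<bar>f n (i + c) j - \<phi> ?y ?t\<bar> < \<epsilon> / 2"
        using elim(2) by auto
      ultimately show "\<bar>f n (i + c) j - \<phi> ?x ?t\<bar> < \<epsilon>" by linarith
    qed
  qed
qed

section \<open>Convergence of differences of intermediate order\<close>

lemma sampled_differences_converge:
  assumes deriv: "\<And>l x t. l < m \<Longrightarrow> (x, t) \<in> st_domain a b t0 T \<Longrightarrow>
      ((\<lambda>y. D l y t) has_real_derivative D (Suc l) x t) (at x)"
    and cont: "continuous_field (D m)"
  shows "converges (\<lambda>n. (fwd_x (g n) ^^ m) (sample (g n) (D 0))) (D m)"
proof (rule convergesI)
  fix x1 x2 \<tau>1 \<tau>2 \<epsilon> :: real
  assume w: "a < x1" "x2 < b" "t0 < \<tau>1" "\<tau>2 < T" and "0 < \<epsilon>"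
  obtain y2 where y: "x2 < y2" "y2 < b" using dense [OF w(2)] by blast
  obtain \<delta> where \<delta>: "0 < \<delta>"
    "\<forall>x\<in>{x1..y2}. \<forall>x'\<in>{x1..y2}. \<forall>t\<in>{\<tau>1..\<tau>2}. \<forall>t'\<in>{\<tau>1..\<tau>2}.
       \<bar>x - x'\<bar> + \<bar>t - t'\<bar> < \<delta> \<longrightarrow> \<bar>D m x t - D m x' t'\<bar> < \<epsilon>"
    by (rule continuous_field_uniform [OF cont w(1) y(2) w(3,4) \<open>0 < \<epsilon>\<close>])
  have "\<forall>\<^sub>F n in sequentially. real m * dx (g n) < min \<delta> (y2 - x2)"
    using y \<delta> by (intro eventually_le_of_null dx_lim) auto
  then show "\<forall>\<^sub>F n in sequentially. \<forall>(i, j)\<in>window n x1 x2 \<tau>1 \<tau>2.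
      \<bar>(fwd_x (g n) ^^ m) (sample (g n) (D 0)) i j - D m (space_node (g n) i) (time_node (g n) j)\<bar> < \<epsilon>"
  proof eventually_elim
    case (elim n)
    show ?case
    proof (intro ballI, clarify)
      fix i j assume ij: "(i, j) \<in> window n x1 x2 \<tau>1 \<tau>2"
      let ?x = "space_node (g n) i" and ?t = "time_node (g n) j"
      have "\<exists>\<xi>. ?x \<le> \<xi> \<and> \<xi> \<le> ?x + real m * dx (g n) \<and>
          (fwd_x (g n) ^^ m) (sample (g n) (D 0)) i j = D m \<xi> ?t"
        by (rule fwd_x_mean_value [where F = "\<lambda>l x. D l x ?t"])
          (use dx_pos ij elim w y in \<open>auto simp: sample_def mem_window st_domain_def intro!: deriv\<close>)
      then obtain \<xi> where \<xi>: "?x \<le> \<xi>" "\<xi> \<le> ?x + real m * dx (g n)"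
        "(fwd_x (g n) ^^ m) (sample (g n) (D 0)) i j = D m \<xi> ?t"
        by blast
      have "\<bar>D m \<xi> ?t - D m ?x ?t\<bar> < \<epsilon>"
        using \<xi>(1,2) ij elim y by (intro \<delta>(2) [rule_format]) (auto simp: mem_window)
      then show "\<bar>(fwd_x (g n) ^^ m) (sample (g n) (D 0)) i j - D m ?x ?t\<bar> < \<epsilon>"
        by (simp add: \<xi>(3))
    qed
  qed
qed

text \<open>The interpolation inequality is used with a span kept between \<open>L / 2\<close> and
  \<open>L\<close> while the cells shrink. Its coefficients then stay bounded, and both suprema tend
  to 0. Forward differences look to the right, so only the right end of the rectangle moves.\<close>

lemma lower_difference_null:
  assumes "converges e (\<lambda>x t. 0)" "converges (\<lambda>n. (fwd_x (g n) ^^ Suc m) (e n)) (\<lambda>x t. 0)"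
  shows "converges (\<lambda>n. (fwd_x (g n) ^^ m) (e n)) (\<lambda>x t. 0)"
proof (rule convergesI)
  fix x1 x2 \<tau>1 \<tau>2 \<epsilon> :: real
  assume w: "a < x1" "x2 < b" "t0 < \<tau>1" "\<tau>2 < T" and "0 < \<epsilon>"
  obtain y2 where y: "x2 < y2" "y2 < b" using dense [OF w(2)] by blast
  \<comment> \<open>A stencil of \<open>m * N\<close> cells then covers at most
    \<open>m * L\<close>, which fits between \<open>x2\<close> and \<open>y2\<close>.
    \<open>Suc m\<close> keeps the quotient meaningful for \<open>m = 0\<close>, and the cap 1
    bounds the coefficient of the higher difference by \<open>m\<close>.\<close>
  define L where "L = min 1 ((y2 - x2) / real (Suc m))"
  have L: "0 < L" "L \<le> 1" using y by (auto simp: L_def)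
  have "L \<le> (y2 - x2) / real (Suc m)" by (simp add: L_def)
  then have "real (Suc m) * L \<le> y2 - x2" by (simp add: pos_le_divide_eq mult.commute)
  with L have mL: "real m * L \<le> y2 - x2" by (simp add: algebra_simps)
  \<comment> \<open>Chosen so that the two terms of the inequality become at most
    \<open>\<epsilon> / 4\<close> and \<open>\<epsilon> / 2\<close>; the slack makes the final bound
    strict.\<close>
  define \<epsilon>0 where "\<epsilon>0 = \<epsilon> / 4 * (L / 2) ^ m / 2 ^ m"
  define \<epsilon>1 where "\<epsilon>1 = \<epsilon> / (2 * real (Suc m))"
  have pos: "0 < \<epsilon>0" "0 < \<epsilon>1" using L \<open>0 < \<epsilon>\<close> by (auto simp: \<epsilon>0_def \<epsilon>1_def)
  have "\<forall>\<^sub>F n in sequentially. 1 * dx (g n) < L / 2"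
    using L by (intro eventually_le_of_null dx_lim) auto
  moreover have "\<forall>\<^sub>F n in sequentially. \<forall>(i, j)\<in>window n x1 y2 \<tau>1 \<tau>2. \<bar>e n i j - 0\<bar> < \<epsilon>0"
    using pos by (intro convergesD [OF assms(1)] y w)
  moreover have "\<forall>\<^sub>F n in sequentially. \<forall>(i, j)\<in>window n x1 y2 \<tau>1 \<tau>2.
      \<bar>(fwd_x (g n) ^^ Suc m) (e n) i j - 0\<bar> < \<epsilon>1"
    using pos by (intro convergesD [OF assms(2)] y w)
  ultimately show "\<forall>\<^sub>F n in sequentially. \<forall>(i, j)\<in>window n x1 x2 \<tau>1 \<tau>2.
      \<bar>(fwd_x (g n) ^^ m) (e n) i j - 0\<bar> < \<epsilon>"
  proof eventually_elim
    case (elim n)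
    \<comment> \<open>Rounding down loses less than one cell, and a cell is shorter than
      \<open>L / 2\<close>.\<close>
    define N where "N = nat \<lfloor>L / dx (g n)\<rfloor>"
    have "1 \<le> L / dx (g n)" using elim(1) L dx_pos [of n] by simp
    then have N: "real N \<le> L / dx (g n)" "L / dx (g n) < real N + 1" "0 < N"
      unfolding N_def by linarith+
    then have H: "real N * dx (g n) \<le> L" "L / 2 \<le> real N * dx (g n)"
      using dx_pos [of n] elim(1) by (simp_all add: field_simps)
    show ?case
    proof (intro ballI, clarify)
      fix i j assume ij: "(i, j) \<in> window n x1 x2 \<tau>1 \<tau>2"
      have near: "(l, j) \<in> window n x1 y2 \<tau>1 \<tau>2" if "i \<le> l" "l \<le> i + int (m * N)" for l
      proof -
        have "0 \<le> real_of_int (l - i)" "real_of_int (l - i) \<le> real m * real N"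
          using that by (simp, metis le_iff_diff_le_0 add.commute diff_le_eq of_int_le_iff of_int_of_nat_eq of_nat_mult)
        then have "0 \<le> of_int (l - i) * dx (g n)"
          "of_int (l - i) * dx (g n) \<le> real m * real N * dx (g n)"
          using dx_pos [of n] by (auto intro: mult_right_mono)
        moreover have "real m * real N * dx (g n) \<le> real m * L"
          using H(1) by (simp add: mult.assoc mult_left_mono)
        moreover have "space_node (g n) l = space_node (g n) i + of_int (l - i) * dx (g n)"
          using space_node_add [of n i "l - i"] by simp
        ultimately show ?thesis using ij mL by (auto simp: mem_window)
      qed
      have "\<bar>(fwd_x (g n) ^^ m) (e n) i j\<bar>
          \<le> 2 ^ m * \<epsilon>0 / (real N * dx (g n)) ^ m + real m * (real N * dx (g n)) * \<epsilon>1"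
      proof (rule fwd_x_interpolation [OF dx_pos N(3)])
        fix l assume l: "i \<le> l" "l \<le> i + int (m * N)"
        show "\<bar>e n l j\<bar> \<le> \<epsilon>0"
          using bspec [OF elim(2) near [OF l]] by simp
        show "\<bar>(fwd_x (g n) ^^ Suc m) (e n) l j\<bar> \<le> \<epsilon>1"
          using bspec [OF elim(3) near [OF l]] by simp
      qed
      also have "2 ^ m * \<epsilon>0 / (real N * dx (g n)) ^ m \<le> 2 ^ m * \<epsilon>0 / (L / 2) ^ m"
        using H(2) L pos N(3) dx_pos [of n]
          by (intro divide_left_mono power_mono mult_pos_pos zero_less_power) auto
      also have "\<dots> = \<epsilon> / 4" using L by (simp add: \<epsilon>0_def)
      also have "real m * (real N * dx (g n)) * \<epsilon>1 \<le> real m * 1 * \<epsilon>1"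
        using H(1) L pos by (intro mult_right_mono mult_left_mono) auto
      also have "real m * 1 * \<epsilon>1 \<le> \<epsilon> / 2" using \<open>0 < \<epsilon>\<close> by (simp add: \<epsilon>1_def field_simps)
      finally show "\<bar>(fwd_x (g n) ^^ m) (e n) i j - 0\<bar> < \<epsilon>" using \<open>0 < \<epsilon>\<close> by simp
    qed
  qed
qed

text \<open>After subtracting the samples of the limit, orders 0 and \<open>q\<close> of the error
  tend to 0. Interpolating between order 0 and order \<open>l + 1\<close> gives order
  \<open>l\<close>, hence the induction downwards from \<open>q\<close>.\<close>

lemma intermediate_differences_converge:
  assumes deriv: "\<And>l x t. l < q \<Longrightarrow> (x, t) \<in> st_domain a b t0 T \<Longrightarrow>
      ((\<lambda>y. D l y t) has_real_derivative D (Suc l) x t) (at x)"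
    and cont: "\<And>l. l \<le> q \<Longrightarrow> continuous_field (D l)"
    and f: "converges f (D 0)" "converges (\<lambda>n. (fwd_x (g n) ^^ q) (f n)) (D q)"
    and "m \<le> q"
  shows "converges (\<lambda>n. (fwd_x (g n) ^^ m) (f n)) (D m)"
proof -
  define e where "e n i j = f n i j - sample (g n) (D 0) i j" for n i j
  have e: "(fwd_x (g n) ^^ l) (e n)
      = (\<lambda>i j. (fwd_x (g n) ^^ l) (f n) i j - (fwd_x (g n) ^^ l) (sample (g n) (D 0)) i j)" for n l
    unfolding e_def by (rule fwd_x_funpow_diff)
  have sampled: "converges (\<lambda>n. (fwd_x (g n) ^^ l) (sample (g n) (D 0))) (D l)" if "l \<le> q" for l
    using that by (intro sampled_differences_converge deriv cont) auto
  have e0: "converges e (\<lambda>x t. 0)"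
    using converges_diff [OF f(1) converges_sample [of "D 0"]] by (simp add: e_def [abs_def])
  have "converges (\<lambda>n. (fwd_x (g n) ^^ m) (e n)) (\<lambda>x t. 0)"
    using \<open>m \<le> q\<close>
  proof (induction m rule: inc_induct)
    case base
    show ?case using converges_diff [OF f(2) sampled [OF order_refl]] by (simp add: e)
  next
    case (step l)
    show ?case by (rule lower_difference_null [OF e0 step.IH])
  qed
  from converges_add [OF this sampled [OF \<open>m \<le> q\<close>]] show ?thesis by (simp add: e)
qed

section \<open>Convergence of the normalised density\<close>

lemma max_dt_nonneg: "0 \<le> max_dt n"
proof -
  have "0 < n_time (g n)" using family by (simp add: grid_family_def grid_on_def)
  then show ?thesis using dt_pos [of 0 n] dt_le_max_dt [of 0 n] by simp
qed

text \<open>A margin of a fixed number of cells or levels has a width tending to 0, whereas the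
  rectangle keeps a fixed distance from the boundary.\<close>

lemma eventually_window_in_stencil:
  assumes "a < x1" "x2 < b" "t0 < \<tau>1" "\<tau>2 < T"
  shows "\<forall>\<^sub>F n in sequentially. window n x1 x2 \<tau>1 \<tau>2 \<subseteq> stencil_points r s0 s1 (g n)"
proof -
  have "\<forall>\<^sub>F n in sequentially. real r * dx (g n) < min (x1 - a) (b - x2)"
    using assms by (intro eventually_le_of_null dx_lim) auto
  moreover have "\<forall>\<^sub>F n in sequentially. real (max s0 s1) * max_dt n < min (\<tau>1 - t0) (T - \<tau>2)"
    using assms by (intro eventually_le_of_null max_dt_lim) auto
  ultimately show ?thesis
  proof eventually_elim
    case (elim n)
    have time: "real c * max_dt n < min (\<tau>1 - t0) (T - \<tau>2)" if "c \<le> max s0 s1" for c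
      using that elim(2) max_dt_nonneg [of n]
      by (elim le_less_trans [rotated]) (auto intro!: mult_right_mono)
    show ?case
    proof clarify
      fix i j assume ij: "(i, j) \<in> window n x1 x2 \<tau>1 \<tau>2"
      have x0: "space_node (g n) i = a + of_int i * dx (g n)"
        using family by (simp add: grid_family_def grid_on_def space_node_def)
      have "a + (real (n_space (g n)) + 1) * dx (g n) = b"
        using family by (simp add: grid_family_def grid_on_def dx_def)
      then have x1: "space_node (g n) i = b - of_int (int (n_space (g n)) + 1 - i) * dx (g n)"
        by (simp add: x0 algebra_simps)
      have "of_int (int r) * dx (g n) < of_int i * dx (g n)"
        using x0 ij elim(1) by (simp add: mem_window)
      then have "int r < i" using dx_pos [of n] by simp
      moreover have "of_int (int r) * dx (g n) < of_int (int (n_space (g n)) + 1 - i) * dx (g n)"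
        using x1 ij elim(1) by (simp add: mem_window)
      then have "int r < int (n_space (g n)) + 1 - i" using dx_pos [of n] by simp
      moreover have "s0 \<le> j"
      proof (rule ccontr)
        assume "\<not> s0 \<le> j"
        then show False
          using time_node_le [of 0 j n] ij time [of j] by (simp add: mem_window time_node_0 le_max_iff_disj)
      qed
      moreover have "j + s1 \<le> n_time (g n)"
      proof (rule ccontr)
        assume *: "\<not> j + s1 \<le> n_time (g n)"
        then have "n_time (g n) - j \<le> s1" by simp
        then show False
          using time_node_le [of j "n_time (g n)" n] ij time [of "n_time (g n) - j"]
          by (simp add: mem_window time_node_last le_max_iff_disj del: of_nat_diff)
      qed
      ultimately show "(i, j) \<in> stencil_points r s0 s1 (g n)"
        by (simp add: stencil_points_def)
    qed
  qed
qed

text \<open>The reference time stays fixed while the grids change, so it need not be a node. Since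
  its predecessor lies before \<open>s\<close>, the node selected overshoots \<open>s\<close> by at
  most one step.\<close>

definition first_node_after :: "real \<Rightarrow> nat \<Rightarrow> nat" where
  "first_node_after s n = (LEAST j. s \<le> time_node (g n) j)"

lemma first_node_after:
  assumes "t0 < s" "s < T"
  shows "first_node_after s n \<le> n_time (g n)"
    and "s \<le> time_node (g n) (first_node_after s n)"
    and "time_node (g n) (first_node_after s n) \<le> s + max_dt n"
proof -
  let ?j = "first_node_after s n"
  have "s \<le> time_node (g n) (n_time (g n))" using assms by (simp add: time_node_last)
  then show le: "?j \<le> n_time (g n)" and s: "s \<le> time_node (g n) ?j"
    unfolding first_node_after_def by (auto intro: Least_le LeastI)
  have "?j \<noteq> 0" using s assms(1) time_node_0 [of n] by (metis not_le)
  then obtain j where j: "?j = Suc j" using not0_implies_Suc by blast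
  then have "\<not> s \<le> time_node (g n) j"
    using not_less_Least [of j "\<lambda>j. s \<le> time_node (g n) j"] by (simp add: first_node_after_def)
  then show "time_node (g n) ?j \<le> s + max_dt n"
    using j le dt_le_max_dt [of j n] by (simp add: time_node_Suc)
qed

text \<open>At the nodes, the increments of \<open>h\<close> and of \<open>\<Gamma>\<close> over one
  step differ by at most \<open>\<eta>\<close> times the step length, and these errors add up to at
  most \<open>\<eta> * (T - t0)\<close>. Subtracting the reference value removes the part of
  \<open>h\<close> that is constant in time, on which its differences give no information.\<close>

lemma time_sums_converge:
  assumes conv: "converges \<phi>h \<phi>" and cont: "continuous_field \<phi>"
    and deriv: "\<And>x t. (x, t) \<in> st_domain a b t0 T \<Longrightarrow> (\<Gamma> x has_real_derivative \<phi> x t) (at t)"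
    and s: "t0 < s" "s < T" and zero: "\<And>x. a < x \<Longrightarrow> x < b \<Longrightarrow> \<Gamma> x s = 0"
    and diff: "\<And>x1 x2 \<tau>1 \<tau>2. a < x1 \<Longrightarrow> x2 < b \<Longrightarrow> t0 < \<tau>1 \<Longrightarrow> \<tau>2 < T \<Longrightarrow>
      \<forall>\<^sub>F n in sequentially. \<forall>(i, j)\<in>window n x1 x2 \<tau>1 \<tau>2. fwd_t (g n) (h n) i j = \<phi>h n i j"
  shows "converges (\<lambda>n i j. h n i j - h n i (first_node_after s n)) \<Gamma>"
proof (rule convergesI)
  fix x1 x2 \<tau>1 \<tau>2 \<epsilon> :: real
  assume w: "a < x1" "x2 < b" "t0 < \<tau>1" "\<tau>2 < T" and "0 < \<epsilon>"
  \<comment> \<open>The summation runs between the level \<open>j\<close> and the reference node, so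
    the time interval must contain \<open>s\<close> as well as the original one, with room for the
    overshoot beyond \<open>s\<close>.\<close>
  obtain \<sigma>1 where \<sigma>1: "t0 < \<sigma>1" "\<sigma>1 < min \<tau>1 s" using w s dense [of t0 "min \<tau>1 s"] by auto
  obtain \<sigma>2 where \<sigma>2: "max \<tau>2 s < \<sigma>2" "\<sigma>2 < T" using w s dense [of "max \<tau>2 s" T] by auto
  obtain B where B: "0 < B" "\<forall>x\<in>{x1..x2}. \<forall>t\<in>{\<sigma>1..\<sigma>2}. \<bar>\<phi> x t\<bar> \<le> B"
    by (rule continuous_field_bounded [OF cont w(1,2) \<sigma>1(1) \<sigma>2(2)])
  define \<eta> where "\<eta> = \<epsilon> / 2 / (T - t0)"
  have \<eta>: "0 < \<eta>" "\<eta> * (T - t0) = \<epsilon> / 2"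
    using \<open>0 < \<epsilon>\<close> tT unfolding \<eta>_def
    by (simp, metis diff_gt_0_iff_gt less_irrefl nonzero_eq_divide_eq)
  obtain \<delta> where \<delta>: "0 < \<delta>"
    "\<forall>x\<in>{x1..x2}. \<forall>x'\<in>{x1..x2}. \<forall>t\<in>{\<sigma>1..\<sigma>2}. \<forall>t'\<in>{\<sigma>1..\<sigma>2}.
       \<bar>x - x'\<bar> + \<bar>t - t'\<bar> < \<delta> \<longrightarrow> \<bar>\<phi> x t - \<phi> x' t'\<bar> < \<eta> / 2"
    by (rule continuous_field_uniform [OF cont w(1,2) \<sigma>1(1) \<sigma>2(2), of "\<eta> / 2"]) (use \<eta> in auto)
  have "\<forall>\<^sub>F n in sequentially. 1 * max_dt n < min \<delta> (\<sigma>2 - s)"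
    using \<delta> \<sigma>2 by (intro eventually_le_of_null max_dt_lim) auto
  moreover have "\<forall>\<^sub>F n in sequentially. B * max_dt n < \<epsilon> / 2"
    using \<open>0 < \<epsilon>\<close> by (intro eventually_le_of_null max_dt_lim) auto
  moreover have "\<forall>\<^sub>F n in sequentially. \<forall>(i, j)\<in>window n x1 x2 \<sigma>1 \<sigma>2.
      \<bar>\<phi>h n i j - \<phi> (space_node (g n) i) (time_node (g n) j)\<bar> < \<eta> / 2"
    by (rule convergesD [OF conv w(1,2) \<sigma>1(1) \<sigma>2(2)]) (use \<eta> in auto)
  moreover note diff [OF w(1,2) \<sigma>1(1) \<sigma>2(2)]
  ultimately show "\<forall>\<^sub>F n in sequentially. \<forall>(i, j)\<in>window n x1 x2 \<tau>1 \<tau>2.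
      \<bar>h n i j - h n i (first_node_after s n) - \<Gamma> (space_node (g n) i) (time_node (g n) j)\<bar> < \<epsilon>"
  proof eventually_elim
    case (elim n)
    let ?t = "time_node (g n)" and ?s = "first_node_after s n"
    note fna = first_node_after [OF s, of n]
    show ?case
    proof (intro ballI, clarify)
      fix i j assume ij: "(i, j) \<in> window n x1 x2 \<tau>1 \<tau>2"
      let ?x = "space_node (g n) i"
      have x: "x1 \<le> ?x" "?x \<le> x2" "a < ?x" "?x < b" using ij w by (auto simp: mem_window)
      have d\<Gamma>: "(\<Gamma> ?x has_real_derivative \<phi> ?x t) (at t)" if "\<sigma>1 \<le> t" "t \<le> \<sigma>2" for t
        using that x \<sigma>1 \<sigma>2 by (intro deriv) (auto simp: st_domain_def)
      define H where "H l = h n i l - \<Gamma> ?x (?t l)" for l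
      have one: "\<bar>H (Suc l) - H l\<bar> \<le> \<eta> * dt (g n) l"
        if l: "l < n_time (g n)" "\<sigma>1 \<le> ?t l" "?t (Suc l) \<le> \<sigma>2" for l
      proof -
        have dt: "0 < dt (g n) l" "dt (g n) l < \<delta>"
          using dt_pos [OF l(1)] dt_le_max_dt [OF l(1)] elim(1) by auto
        have "\<exists>\<xi>. ?t l < \<xi> \<and> \<xi> < ?t (Suc l) \<and>
            \<Gamma> ?x (?t (Suc l)) - \<Gamma> ?x (?t l) = (?t (Suc l) - ?t l) * \<phi> ?x \<xi>"
          by (rule MVT2) (use dt l in \<open>auto simp: time_node_Suc intro!: d\<Gamma>\<close>)
        then obtain \<xi> where \<xi>: "?t l < \<xi>" "\<xi> < ?t (Suc l)"
          "\<Gamma> ?x (?t (Suc l)) - \<Gamma> ?x (?t l) = dt (g n) l * \<phi> ?x \<xi>"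
          by (auto simp: time_node_Suc)
        have il: "(i, l) \<in> window n x1 x2 \<sigma>1 \<sigma>2"
          using l x dt by (simp add: mem_window time_node_Suc)
        then have "h n i (Suc l) - h n i l = dt (g n) l * \<phi>h n i l"
          using bspec [OF elim(4) il] dt(1) by (simp add: fwd_t_def field_simps)
        then have H: "H (Suc l) - H l = dt (g n) l * (\<phi>h n i l - \<phi> ?x \<xi>)"
          using \<xi>(3) by (simp add: H_def algebra_simps)
        have "\<bar>\<phi>h n i l - \<phi> ?x (?t l)\<bar> < \<eta> / 2"
          using bspec [OF elim(3) il] by simp
        moreover have "\<bar>\<phi> ?x (?t l) - \<phi> ?x \<xi>\<bar> < \<eta> / 2"
          using \<xi>(1,2) l x dt(2) by (intro \<delta>(2) [rule_format]) (auto simp: time_node_Suc)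
        ultimately have "\<bar>\<phi>h n i l - \<phi> ?x \<xi>\<bar> \<le> \<eta>" by linarith
        then show ?thesis
          using dt(1) by (simp add: H abs_mult mult.commute)
      qed
      have tele: "\<bar>H l' - H l\<bar> \<le> \<eta> * (?t l' - ?t l)"
        if "l \<le> l'" "l' \<le> n_time (g n)" "\<sigma>1 \<le> ?t l" "?t l' \<le> \<sigma>2" for l l'
        using that
      proof (induction l' rule: dec_induct)
        case (step l')
        have l': "l' < n_time (g n)" using step.prems by simp
        have mono: "?t l \<le> ?t l'" by (rule time_node_mono) (use step.hyps l' in simp_all)
        have "?t l' \<le> ?t (Suc l')" using dt_pos [OF l'] by (simp add: time_node_Suc)
        with step.prems l' have "\<bar>H l' - H l\<bar> \<le> \<eta> * (?t l' - ?t l)"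
          by (intro step.IH) linarith+
        moreover have "\<bar>H (Suc l') - H l'\<bar> \<le> \<eta> * dt (g n) l'"
          by (rule one [OF l']) (use mono step.prems in linarith)+
        moreover have "\<eta> * (?t (Suc l') - ?t l) = \<eta> * (?t l' - ?t l) + \<eta> * dt (g n) l'"
          by (simp add: time_node_Suc distrib_left [symmetric])
        ultimately show ?case by linarith
      qed simp
      have j: "j \<le> n_time (g n)" "\<sigma>1 \<le> ?t j" "?t j \<le> \<sigma>2"
        using ij \<sigma>1 \<sigma>2 by (auto simp: mem_window)
      have js: "\<sigma>1 \<le> ?t ?s" "?t ?s \<le> \<sigma>2" using fna elim(1) \<sigma>1 by auto
      have "\<bar>H j - H ?s\<bar> \<le> \<eta> * \<bar>?t j - ?t ?s\<bar>"
      proof (cases "?s \<le> j")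
        case True
        then show ?thesis using tele [of ?s j] time_node_mono [of ?s j n] j js by simp
      next
        case False
        then show ?thesis
          using tele [of j ?s] time_node_mono [of j ?s n] j js fna(1)
          by (simp add: abs_minus_commute)
      qed
      also have "\<dots> \<le> \<eta> * (T - t0)"
        using \<eta>(1) j js \<sigma>1 \<sigma>2 by (intro mult_left_mono) auto
      also have "\<dots> = \<epsilon> / 2" by (rule \<eta>(2))
      finally have 1: "\<bar>H j - H ?s\<bar> \<le> \<epsilon> / 2" .
      \<comment> \<open>\<open>\<Gamma>\<close> vanishes at \<open>s\<close> and not at the
        reference node; the discrepancy is controlled by the bound on its derivative and the
        overshoot.\<close>
      have "\<bar>\<Gamma> ?x (?t ?s)\<bar> \<le> B * (?t ?s - s)"
      proof (cases "?t ?s = s")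
        case True
        then show ?thesis using zero [OF x(3,4)] by simp
      next
        case False
        with fna have less: "s < ?t ?s" by simp
        have "\<exists>\<xi>. s < \<xi> \<and> \<xi> < ?t ?s \<and> \<Gamma> ?x (?t ?s) - \<Gamma> ?x s = (?t ?s - s) * \<phi> ?x \<xi>"
          by (rule MVT2 [OF less d\<Gamma>]) (use js \<sigma>1 in linarith)+
        then obtain \<xi> where \<xi>: "s < \<xi>" "\<xi> < ?t ?s" "\<Gamma> ?x (?t ?s) = (?t ?s - s) * \<phi> ?x \<xi>"
          using zero [OF x(3,4)] by auto
        have "\<bar>\<phi> ?x \<xi>\<bar> \<le> B" using B(2) x(1,2) \<xi>(1,2) js \<sigma>1 by simp
        then show ?thesis using less by (simp add: \<xi>(3) abs_mult mult.commute)
      qed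
      also have "\<dots> \<le> B * max_dt n" using B(1) fna(3) by simp
      also have "\<dots> < \<epsilon> / 2" by (rule elim(2))
      finally have "\<bar>\<Gamma> ?x (?t ?s)\<bar> < \<epsilon> / 2" .
      moreover have "h n i j - h n i ?s - \<Gamma> ?x (?t j) = (H j - H ?s) - \<Gamma> ?x (?t ?s)"
        by (simp add: H_def)
      ultimately show "\<bar>h n i j - h n i ?s - \<Gamma> ?x (?t j)\<bar> < \<epsilon>"
        using 1 by linarith
    qed
  qed
qed

section \<open>Convergence of the discrete flux\<close>

lemma converges_centring:
  assumes "converges f \<phi>" "continuous_field \<phi>"
  shows "converges (\<lambda>n. centring q (f n)) \<phi>"
proof (cases "even q")
  case True
  then show ?thesis using converges_shift [OF assms, of "- int (q div 2)"]
    by (simp add: centring_def [abs_def])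
next
  case False
  have "converges (\<lambda>n i j. 1 / 2 * (f n (i + (- int (q div 2))) j + f n (i + (- int (q div 2) - 1)) j))
      (\<lambda>x t. 1 / 2 * (\<phi> x t + \<phi> x t))"
    by (rule converges_cmult [OF converges_add [OF converges_shift [OF assms] converges_shift [OF assms]]])
  then show ?thesis using False by (simp add: centring_def [abs_def])
qed

lemma continuous_field_time:
  assumes "continuous_on {t0<..<T} \<rho>"
  shows "continuous_field (\<lambda>x t. \<rho> t)"
  unfolding case_prod_unfold
  by (rule continuous_on_compose2 [OF assms]) (auto simp: st_domain_def intro!: continuous_intros)

text \<open>Interpolation is applied to the centred grid function and not to \<open>f\<close>: it is
  the former whose forward difference of order \<open>q\<close> is \<open>centred\<close>. Products
  then converge term by term because all limits are continuous.\<close>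

lemma discrete_flux_converges:
  assumes f: "converges f \<phi>" "converges (\<lambda>n. centred (g n) q (f n)) (dx_pow q \<phi>)"
    and diff: "\<And>m x t. m < q \<Longrightarrow> (x, t) \<in> st_domain a b t0 T \<Longrightarrow>
      (\<lambda>y. dx_pow m \<phi> y t) differentiable (at x)"
    and cont: "\<And>m. m \<le> q \<Longrightarrow> continuous_field (dx_pow m \<phi>)"
    and \<rho>: "continuous_on {t0<..<T} \<rho>" and "k < q"
  shows "converges (\<lambda>n. discrete_flux (g n) \<rho> k q (f n)) (flux \<rho> k q \<phi>)"
proof -
  have \<phi>0: "dx_pow 0 \<phi> = \<phi>" by (simp add: dx_pow_def fun_eq_iff)
  have w: "converges (\<lambda>n. (fwd_x (g n) ^^ m) (centring q (f n))) (dx_pow m \<phi>)" if "m \<le> q" for m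
  proof (rule intermediate_differences_converge [where D = "\<lambda>m. dx_pow m \<phi>", OF _ cont _ _ that])
    show "converges (\<lambda>n. centring q (f n)) (dx_pow 0 \<phi>)"
      using converges_centring f(1) cont [of 0] by (simp add: \<phi>0)
    show "converges (\<lambda>n. (fwd_x (g n) ^^ q) (centring q (f n))) (dx_pow q \<phi>)"
      using f(2) by (simp add: centred_eq_fwd_x)
  qed (auto intro: dx_pow_has_derivative diff)
  have cP: "continuous_field (\<lambda>x t. monomial_deriv k m x)" for m
    unfolding case_prod_unfold by (rule continuous_on_monomial_deriv)
  have P: "converges (\<lambda>n. (fwd_x (g n) ^^ m) (sample (g n) (\<lambda>x t. x ^ k))) (\<lambda>x t. monomial_deriv k m x)" for m
    using sampled_differences_converge [of m "\<lambda>m x t. monomial_deriv k m x"]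
    by (simp add: monomial_deriv_has_derivative monomial_deriv_0 cP)
  let ?S = "\<lambda>n i j. \<Sum>m\<le>k. (-1) ^ m * ((fwd_x (g n) ^^ m) (sample (g n) (\<lambda>x t. x ^ k)) i j
      * (fwd_x (g n) ^^ (q - 1 - m)) (centring q (f n)) (i + int m) j)"
  let ?\<Sigma> = "\<lambda>x t. \<Sum>m\<le>k. (-1) ^ m * (monomial_deriv k m x * dx_pow (q - 1 - m) \<phi> x t)"
  have "converges ?S ?\<Sigma>"
  proof (rule converges_sum)
    fix m
    have q: "q - 1 - m \<le> q" by simp
    show "converges (\<lambda>n i j. (-1) ^ m * ((fwd_x (g n) ^^ m) (sample (g n) (\<lambda>x t. x ^ k)) i j
        * (fwd_x (g n) ^^ (q - 1 - m)) (centring q (f n)) (i + int m) j))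
      (\<lambda>x t. (-1) ^ m * (monomial_deriv k m x * dx_pow (q - 1 - m) \<phi> x t))"
      by (rule converges_cmult [OF converges_mult
            [OF P converges_shift [OF w [OF q] cont [OF q]] cP cont [OF q]]])
  qed simp
  from converges_cmult [OF converges_mult_sample [OF this continuous_field_time [OF \<rho>]], of "-1"]
  show ?thesis by (simp add: discrete_flux_def [abs_def] flux_def [abs_def])
qed


end

section \<open>Antiderivatives in time and the conservation laws\<close>

text \<open>The integrand may be unbounded near the left end, where a fractional derivative can be
  singular. The additive constant is therefore fixed by the value at \<open>s\<close> and not by
  integrating from \<open>c\<close>.\<close>

lemma open_interval_antiderivative:
  fixes f :: "real \<Rightarrow> real"
  assumes "continuous_on {c<..<d} f" "c < d"
  shows "\<exists>F. F s = 0 \<and> (\<forall>t\<in>{c<..<d}. (F has_real_derivative f t) (at t))"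
proof -
  have "isCont f t" if "c < t" "t < d" for t
    using that assms(1) by (simp add: continuous_on_eq_continuous_at)
  then obtain F where F: "\<forall>t. ereal c < ereal t \<longrightarrow> ereal t < ereal d \<longrightarrow> (F has_vector_derivative f t) (at t)"
    using einterval_antiderivative [of "ereal c" "ereal d" f] assms(2) by auto
  have "((\<lambda>t. F t - F s) has_real_derivative f t) (at t)" if "t \<in> {c<..<d}" for t
    using that F by (auto simp: has_real_derivative_iff_has_vector_derivative intro!: derivative_eq_intros)
  then show ?thesis by (intro exI [of _ "\<lambda>t. F t - F s"]) simp
qed

theorem theorem2:
  fixes a b t0 T \<alpha> :: real and p q d r s0 s1 :: nat
    and \<kappa> :: "real list \<Rightarrow> real" and K Dt :: functional
    and g :: "nat \<Rightarrow> grid"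
    and Dh Kh Gbar :: discrete_functional
    and \<rho> :: "real \<Rightarrow> real"
  defines "K \<equiv> jet_functional d \<kappa>"
    and "\<Omega> \<equiv> st_domain a b t0 T"
    and "A \<equiv> admissible a b t0 T Dt q K"
    and "pts \<equiv> (\<lambda>n. stencil_points r s0 s1 (g n))"
    and "R \<equiv> pde_residual Dt q K"
    and "Rh \<equiv> scheme_residual g Dh q Kh"
  assumes "a < b" and "t0 < T"
    and "1 \<le> p" and "1 \<le> q" and "real p - 1 < \<alpha>" and "\<alpha> < real p"
    and "Dt = rl_deriv t0 p \<alpha> \<or> Dt = caputo_deriv t0 p \<alpha>"
    and "grid_family a b t0 T g"
    and "(q + 1) div 2 \<le> r" and "1 \<le> s1"
    and "discretizes A \<Omega> g Dh Dt"
    and "discretizes A \<Omega> g Kh K"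
    and "discretizes A \<Omega> g Rh R"
    and "continuous_on {t0<..<T} \<rho>"
    and "\<And>n u i j. (i, j) \<in> pts n \<Longrightarrow>
           \<rho> (time_node (g n) j) * Dh n u i j = fwd_t (g n) (Gbar n u) i j"
  shows "\<forall>k<q.
    (let Qh = (\<lambda>n u i j. space_node (g n) i ^ k * \<rho> (time_node (g n) j) * Rh n u i j);
         Q = (\<lambda>u x t. x ^ k * \<rho> t * R u x t)
     in (\<exists>Fh Gh c. discrete_conservation_law A \<Omega> g pts Rh R Qh Q Fh Gh \<and>
           (\<forall>n u i j. Gh n u i j = space_node (g n) i ^ k * (Gbar n u i j - c n u i)) \<and>
           local_in q Kh Fh) \<and>
        (\<forall>u P e. A u \<and> P \<subseteq> \<Omega> \<and> bounded (\<rho> ` snd ` P) \<and>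
           accurate_to_order g pts P e Rh R u \<longrightarrow> accurate_to_order g pts P e Qh Q u))"
proof -
  interpret grid_refinement a b t0 T g
    using \<open>a < b\<close> \<open>t0 < T\<close> \<open>grid_family a b t0 T g\<close> by unfold_locales
  define s where "s = (t0 + T) / 2"
  have s: "t0 < s" "s < T" using tT by (auto simp: s_def)
  have Kdiff: "(\<lambda>y. dx_pow m (K u) y t) differentiable (at x)"
    if "A u" "m < q" "(x, t) \<in> \<Omega>" for u m x t
    using that unfolding A_def admissible_def \<Omega>_def by blast
  have Kcont: "continuous_field (dx_pow m (K u))" if "A u" "m \<le> q" for u m
    using that unfolding A_def admissible_def by blast
  have Dtcont: "continuous_field (Dt u)" if "A u" for u
    using that unfolding A_def admissible_def by blast
  note \<rho>cont = continuous_field_time [OF \<open>continuous_on {t0<..<T} \<rho>\<close>]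
  have Dhconv: "converges (\<lambda>n. Dh n (sample (g n) u)) (Dt u)" if "A u" for u
    using \<open>discretizes A \<Omega> g Dh Dt\<close> that unfolding \<Omega>_def discretizes_iff by blast
  have Khconv: "converges (\<lambda>n. Kh n (sample (g n) u)) (K u)" if "A u" for u
    using \<open>discretizes A \<Omega> g Kh K\<close> that unfolding \<Omega>_def discretizes_iff by blast
  have Rhconv: "converges (\<lambda>n. Rh n (sample (g n) u)) (R u)" if "A u" for u
    using \<open>discretizes A \<Omega> g Rh R\<close> that unfolding \<Omega>_def discretizes_iff by blast
  \<comment> \<open>Convergence of the spatial term follows by subtracting the residual from the
    time part, both of which converge.\<close>
  have centredconv: "converges (\<lambda>n. centred (g n) q (Kh n (sample (g n) u))) (dx_pow q (K u))"
    if "A u" for u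
    using converges_diff [OF Dhconv [OF that] Rhconv [OF that]]
    by (simp add: Rh_def R_def scheme_residual_def pde_residual_def)
  \<comment> \<open>The choice is made for each \<open>x\<close> separately: the density built from
    it is differentiated in time only.\<close>
  define \<Gamma> where "\<Gamma> u x = (SOME F. F s = 0 \<and>
    (\<forall>t\<in>{t0<..<T}. (F has_real_derivative \<rho> t * Dt u x t) (at t)))" for u x
  have \<Gamma>: "\<Gamma> u x s = 0 \<and> (\<forall>t\<in>{t0<..<T}. (\<Gamma> u x has_real_derivative \<rho> t * Dt u x t) (at t))"
    if "A u" "a < x" "x < b" for u x
  proof -
    have "continuous_on {t0<..<T} (\<lambda>t. case (x, t) of (x, t) \<Rightarrow> Dt u x t)"
      by (rule continuous_on_compose2 [OF Dtcont [OF \<open>A u\<close>]])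
        (use that in \<open>auto simp: st_domain_def intro!: continuous_intros\<close>)
    then have "continuous_on {t0<..<T} (\<lambda>t. \<rho> t * Dt u x t)"
      using \<open>continuous_on {t0<..<T} \<rho>\<close> by (auto intro: continuous_intros)
    from open_interval_antiderivative [OF this tT, of s] show ?thesis
      unfolding \<Gamma>_def by (rule someI_ex)
  qed
  have Gconv: "converges (\<lambda>n i j. Gbar n (sample (g n) u) i j - Gbar n (sample (g n) u) i (first_node_after s n)) (\<Gamma> u)"
    if "A u" for u
  proof (rule time_sums_converge [OF _ _ _ s])
    show "converges (\<lambda>n i j. \<rho> (time_node (g n) j) * Dh n (sample (g n) u) i j) (\<lambda>x t. \<rho> t * Dt u x t)"
      by (rule converges_mult_sample [OF Dhconv [OF that] \<rho>cont])
    show "continuous_field (\<lambda>x t. \<rho> t * Dt u x t)"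
      using continuous_on_mult [OF \<rho>cont Dtcont [OF that]] by (simp add: case_prod_unfold)
    show "(\<Gamma> u x has_real_derivative \<rho> t * Dt u x t) (at t)" if "(x, t) \<in> st_domain a b t0 T" for x t
      using that \<Gamma> [OF \<open>A u\<close>, of x] by (auto simp: st_domain_def)
    show "\<Gamma> u x s = 0" if "a < x" "x < b" for x
      using \<Gamma> [OF \<open>A u\<close> that] by blast
    fix x1 x2 \<tau>1 \<tau>2
    assume "a < x1" "x2 < b" "t0 < \<tau>1" "\<tau>2 < T"
    \<comment> \<open>The identity for \<open>Gbar\<close> is available at stencil points only,
      which contain every interior rectangle once the grid is fine enough.\<close>
    from eventually_window_in_stencil [OF this, of r s0 s1]
    show "\<forall>\<^sub>F n in sequentially. \<forall>(i, j)\<in>window n x1 x2 \<tau>1 \<tau>2.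
        fwd_t (g n) (Gbar n (sample (g n) u)) i j = \<rho> (time_node (g n) j) * Dh n (sample (g n) u) i j"
    proof eventually_elim
      case (elim n)
      then show ?case using assms(21) by (auto simp: pts_def)
    qed
  qed
  have law: "\<exists>Fh Gh c. discrete_conservation_law A \<Omega> g pts Rh R
        (\<lambda>n u i j. space_node (g n) i ^ k * \<rho> (time_node (g n) j) * Rh n u i j)
        (\<lambda>u x t. x ^ k * \<rho> t * R u x t) Fh Gh \<and>
      (\<forall>n u i j. Gh n u i j = space_node (g n) i ^ k * (Gbar n u i j - c n u i)) \<and>
      local_in q Kh Fh" if k: "k < q" for k
  proof -
    \<comment> \<open>Independent of \<open>j\<close>, so it drops out of the time difference and
      leaves the discrete divergence unchanged; its only effect is to make the density
      converge.\<close>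
    define c where "c n u i = Gbar n u i (first_node_after s n)" for n u i
    define Fh where "Fh n u = discrete_flux (g n) \<rho> k q (Kh n u)" for n u
    define Gh where "Gh n u i j = space_node (g n) i ^ k * (Gbar n u i j - c n u i)" for n u i j
    define F where "F u = flux \<rho> k q (K u)" for u
    define G where "G u x t = x ^ k * \<Gamma> u x t" for u x t
    have "space_node (g n) i ^ k * \<rho> (time_node (g n) j) * Rh n u i j
        = fwd_x (g n) (Fh n u) i j + fwd_t (g n) (Gh n u) i j" if "(i, j) \<in> pts n" for n u i j
    proof -
      have "fwd_t (g n) (Gh n u) i j = space_node (g n) i ^ k * fwd_t (g n) (Gbar n u) i j"
        by (simp add: fwd_t_def Gh_def right_diff_distrib [symmetric])
      also have "\<dots> = space_node (g n) i ^ k * (\<rho> (time_node (g n) j) * Dh n u i j)"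
        by (simp add: assms(21) [OF that])
      finally show ?thesis
        by (simp add: Fh_def fwd_x_discrete_flux [OF dx_pos k] Rh_def scheme_residual_def algebra_simps)
    qed
    moreover have "conservation_law A \<Omega> R (\<lambda>u x t. x ^ k * \<rho> t * R u x t) F G"
    proof -
      have "(\<lambda>y. F u y t) differentiable (at x) \<and> (\<lambda>s. G u x s) differentiable (at t) \<and>
          x ^ k * \<rho> t * R u x t = deriv (\<lambda>y. F u y t) x + deriv (\<lambda>s. G u x s) t"
        if "A u" "(x, t) \<in> \<Omega>" for u x t
      proof -
        have dF: "((\<lambda>y. F u y t) has_real_derivative - (x ^ k * \<rho> t * dx_pow q (K u) x t)) (at x)"
          unfolding F_def by (rule flux_has_derivative [OF _ k]) (rule Kdiff [OF that(1) _ that(2)])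
        have "(\<Gamma> u x has_real_derivative \<rho> t * Dt u x t) (at t)"
          using \<Gamma> [OF that(1), of x] that(2) by (auto simp: \<Omega>_def st_domain_def)
        then have dG: "((\<lambda>s. G u x s) has_real_derivative x ^ k * (\<rho> t * Dt u x t)) (at t)"
          unfolding G_def by (rule DERIV_cmult)
        show ?thesis
          using dF dG DERIV_imp_deriv [OF dF] DERIV_imp_deriv [OF dG]
          by (auto simp: real_differentiable_def R_def pde_residual_def algebra_simps)
      qed
      then show ?thesis unfolding conservation_law_def by auto
    qed
    moreover have "discretizes A \<Omega> g Fh F"
      unfolding \<Omega>_def discretizes_iff Fh_def F_def
    proof (intro allI impI discrete_flux_converges)
      fix u assume "A u"
      show "(\<lambda>y. dx_pow m (K u) y t) differentiable (at x)" if "m < q" "(x, t) \<in> st_domain a b t0 T" for m x t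
        using Kdiff [OF \<open>A u\<close>] that by (simp add: \<Omega>_def)
    qed (use Khconv centredconv Kcont k \<open>continuous_on {t0<..<T} \<rho>\<close> in auto)
    moreover have "discretizes A \<Omega> g Gh G"
      unfolding \<Omega>_def discretizes_iff Gh_def G_def c_def
    proof (intro allI impI)
      fix u assume "A u"
      have "continuous_field (\<lambda>x t. x ^ k)"
        unfolding case_prod_unfold by (intro continuous_intros)
      from converges_mult_sample [OF Gconv [OF \<open>A u\<close>] this]
      show "converges (\<lambda>n i j. space_node (g n) i ^ k * (Gbar n (sample (g n) u) i j
          - Gbar n (sample (g n) u) i (first_node_after s n))) (\<lambda>x t. x ^ k * \<Gamma> u x t)" .
    qed
    moreover have "local_in q Kh Fh"
      unfolding local_in_def Fh_def by (auto intro: discrete_flux_local k)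
    ultimately show ?thesis
      unfolding discrete_conservation_law_def
      by (intro exI [of _ Fh] exI [of _ Gh] exI [of _ c]) (auto simp: Gh_def)
  qed
  \<comment> \<open>The discrete and the continuous multiplier coincide at each node, so the error
    is multiplied exactly by the absolute value of \<open>x ^ k * \<rho> t\<close>. This is bounded
    on \<open>P\<close> because \<open>x\<close> ranges over a bounded interval and
    \<open>\<rho>\<close> is bounded on the times occurring in \<open>P\<close>.\<close>
  have accuracy: "accurate_to_order g pts P e
        (\<lambda>n u i j. space_node (g n) i ^ k * \<rho> (time_node (g n) j) * Rh n u i j)
        (\<lambda>u x t. x ^ k * \<rho> t * R u x t) u"
    if P: "P \<subseteq> \<Omega>" "bounded (\<rho> ` snd ` P)" and acc: "accurate_to_order g pts P e Rh R u" for k u P e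
  proof -
    obtain C where C: "\<forall>\<^sub>F n in sequentially. \<forall>(i, j)\<in>pts n.
        node (g n) (i, j) \<in> P \<longrightarrow> sampling_error g Rh R u n i j \<le> C * e n"
      using acc unfolding accurate_to_order_def by blast
    obtain B where B: "0 < B" "\<And>y. y \<in> \<rho> ` snd ` P \<Longrightarrow> norm y \<le> B"
      using P(2) unfolding bounded_pos by blast
    define M where "M = max \<bar>a\<bar> \<bar>b\<bar> ^ k * B"
    have M: "\<bar>x ^ k * \<rho> t\<bar> \<le> M" if "(x, t) \<in> P" for x t
    proof -
      have "a < x \<and> x < b" using that \<open>P \<subseteq> \<Omega>\<close> by (auto simp: \<Omega>_def st_domain_def)
      then have "\<bar>x\<bar> \<le> max \<bar>a\<bar> \<bar>b\<bar>" by linarith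
      then have "\<bar>x\<bar> ^ k \<le> max \<bar>a\<bar> \<bar>b\<bar> ^ k" by (intro power_mono) auto
      moreover have "\<bar>\<rho> t\<bar> \<le> B" using B(2) [of "\<rho> t"] that by force
      ultimately show ?thesis
        unfolding M_def abs_mult power_abs using B(1) by (intro mult_mono) auto
    qed
    show ?thesis
      unfolding accurate_to_order_def
    proof (intro exI [of _ "M * C"])
      from C show "\<forall>\<^sub>F n in sequentially. \<forall>(i, j)\<in>pts n. node (g n) (i, j) \<in> P \<longrightarrow>
          sampling_error g (\<lambda>n u i j. space_node (g n) i ^ k * \<rho> (time_node (g n) j) * Rh n u i j)
            (\<lambda>u x t. x ^ k * \<rho> t * R u x t) u n i j \<le> M * C * e n"
      proof eventually_elim
        case (elim n)
        show ?case
        proof (intro ballI, clarify)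
          fix i j assume ij: "(i, j) \<in> pts n" and P: "node (g n) (i, j) \<in> P"
          let ?x = "space_node (g n) i" and ?t = "time_node (g n) j"
          have err: "sampling_error g Rh R u n i j \<le> C * e n"
            using bspec [OF elim ij] P by simp
          have "\<bar>?x ^ k * \<rho> ?t\<bar> \<le> M" using P by (intro M) (simp add: node_def)
          then have "\<bar>?x ^ k * \<rho> ?t\<bar> * sampling_error g Rh R u n i j \<le> M * (C * e n)"
            using err by (intro mult_mono) (auto simp: sampling_error_def M_def intro: order_trans [OF abs_ge_zero])
          then show "sampling_error g (\<lambda>n u i j. space_node (g n) i ^ k * \<rho> (time_node (g n) j) * Rh n u i j)
              (\<lambda>u x t. x ^ k * \<rho> t * R u x t) u n i j \<le> M * C * e n"
            by (simp add: sampling_error_def right_diff_distrib [symmetric] abs_mult mult.assoc)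
        qed
      qed
    qed
  qed
  show ?thesis
    unfolding Let_def using law accuracy by blast
qed

end
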